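(* Given $1\le p<\infty$, there is a Banach space $X$ with a normalized Schauder basis $\mathcal{X}=(x_n)_{n=1}^\infty$ such that (i) $\mathcal{X}$ is quasi-greedy for largest coefficients (QGLC) and lower unconditional for constant coefficients (LUCC), hence lattice partially unconditional (LPU); (ii) $\mathcal{X}$ is democratic, and its fundamental function satisfies $\varphi_u(m)\approx m^{1/p}$ for $m\in\mathbb{N}$, i.e. there is a constant $C\ge1$ with $C^{-1}m^{1/p}\le\varphi_u(m)\le Cm^{1/p}$ for all $m\in\mathbb{N}$; (iii) $\mathcal{X}$ is not truncation quasi-greedy.
   Context: $\mathbb{N}$ is the set of positive integers; the scalar field $\mathbb{F}$ is $\mathbb{R}$ or $\mathbb{C}$; $\mathbb{E}=\{\lambda\in\mathbb{F}:|\lambda|=1\}$. A Schauder basis of $X$ is a sequence $(x_n)$ such that every $f\in X$ has a unique norm-convergent expansion $f=\sum_n a_nx_n$; $(x_n^* )$ denotes the biorthogonal functionals. It is normalized if $\|x_n\|=1$ for all $n$. For finite $A\subset\mathbb{N}$ and $\varepsilon\in\mathbb{E}^A$, $S_A(f)=\sum_{n\in A}x_n^*(f)x_n$ and $\mathbf{1}_{\varepsilon,A}=\sum_{n\in A}\varepsilon_nx_n$. Let $\mathrm{sign}(\lambda)=\lambda/|\lambda|$ for $\lambda\ne0$, $\mathrm{sign}(0)=1$, and $\varepsilon(f)=(\mathrm{sign}(x_n^*(f)))_n$. For nonempty finite $A$, $\mathrm{osc}(f,A)=\max_{n\in A}|x_n^*(f)|/\min_{n\in A}|x_n^*(f)|$,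 with $0/0=1$ and $a/0=\infty$ for $a>0$. A finite set $A\subset\mathbb{N}$ is a greedy set of $f$ if $|x_n^*(f)|\ge|x_k^*(f)|$ for all $n\in A$, $k\in\mathbb{N}\setminus A$. The basis is: - quasi-greedy for largest coefficients (QGLC) if there is $C$ with $\|S_A(f)\|\le C\|f\|$ for all $f\in X$ and all greedy sets $A$ of $f$ with $\mathrm{osc}(f,A)=1$; equivalently, $\|\mathbf{1}_{\varepsilon,A}\|\le C\|\mathbf{1}_{\varepsilon,A}+f\|$ for all finite $A$, all $\varepsilon\in\mathbb{E}^A$, and all $f\in X$ with $\sup_n|x_n^*(f)|\le1$ and $x_n^*(f)=0$ for $n\in A$; - truncation quasi-greedy if there is $C$ with $\min_{n\in A}|x_n^*(f)|\,\|\mathbf{1}_{\varepsilon(f),A}\|\le C\|f\|$ for all $f\in X$ and all nonempty greedy sets $A$ of $f$. Consider the inequality $( * )$: $\|\sum_{n\in A}b_nx_n\|\le C\|\sum_{n\in A}a_nx_n\|$. The basis is LPU if there is $C$ such that $( * )$ holds for all finite $A$ and all scalar families with $\sup_{n\in A}|b_n|\le\inf_{n\in A}|a_n|$. It is LUCC if there is $C$ such that $( * )$ holds for all finite $A$ and all scalar families such that, for every $n\in A$, $|b_n|=1$ and $a_n/b_n$ is a real number in $[1,\infty)$. The basis is democratic if there is $C$ such that $\|\sum_{n\in A}x_n\|\le C\|\sum_{n\in B}x_n\|$ for all finite $A,B\subset\mathbb{N}$ with $|A|\le|B|$. The fundamental function is $\varphi_u(m)=\sup\{\|\mathbf{1}_{\varepsilon,A}\|:|A|\le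 m,\ \varepsilon\in\mathbb{E}^A\}$. *)

theory Defs
  imports "HOL-Analysis.Analysis" "HOL-Library.Function_Algebras"
begin

text \<open>
  HOL cannot quantify existentially over types, so a Banach space is a complete normed subspace
  \<open>X\<close> of an ambient vector space type. The ambient vector space itself carries no norm:
  \<open>nrm\<close> is only constrained on \<open>X\<close>.
  Basis vectors are indexed by \<^typ>\<open>nat\<close> starting from \<open>0\<close>,
  so \<open>x n\<close> stands for \<open>x_{n+1}\<close>.
\<close>

locale banach_space_on = vector_space smul
  for smul :: "'k::real_normed_field \<Rightarrow> 'v::ab_group_add \<Rightarrow> 'v" +
  fixes X :: "'v set" and nrm :: "'v \<Rightarrow> real"
  assumes subspace_X: "subspace X"
    and nrm_nonneg: "f \<in> X \<Longrightarrow> 0 \<le> nrm f"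
    and nrm_eq_0_iff: "f \<in> X \<Longrightarrow> nrm f = 0 \<longleftrightarrow> f = 0"
    and nrm_scale: "f \<in> X \<Longrightarrow> nrm (smul c f) = norm c * nrm f"
    and nrm_triangle: "f \<in> X \<Longrightarrow> g \<in> X \<Longrightarrow> nrm (f + g) \<le> nrm f + nrm g"
    and complete_X:
      "(\<forall>i. F i \<in> X) \<Longrightarrow> (\<forall>e>0. \<exists>M. \<forall>i\<ge>M. \<forall>j\<ge>M. nrm (F i - F j) < e) \<Longrightarrow>
        \<exists>f\<in>X. (\<lambda>i. nrm (F i - f)) \<longlonglongrightarrow> 0"

definition lin_comb :: "('k \<Rightarrow> 'v::comm_monoid_add \<Rightarrow> 'v) \<Rightarrow> (nat \<Rightarrow> 'v) \<Rightarrow> (nat \<Rightarrow> 'k) \<Rightarrow> nat set \<Rightarrow> 'v" where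
  "lin_comb smul x a A = (\<Sum>n\<in>A. smul (a n) (x n))"

definition is_expansion ::
  "('k \<Rightarrow> 'v::ab_group_add \<Rightarrow> 'v) \<Rightarrow> ('v \<Rightarrow> real) \<Rightarrow> (nat \<Rightarrow> 'v) \<Rightarrow> 'v \<Rightarrow> (nat \<Rightarrow> 'k) \<Rightarrow> bool" where
  "is_expansion smul nrm x f a \<longleftrightarrow> (\<lambda>m. nrm (f - lin_comb smul x a {..<m})) \<longlonglongrightarrow> 0"

definition schauder_basis ::
  "('k \<Rightarrow> 'v::ab_group_add \<Rightarrow> 'v) \<Rightarrow> 'v set \<Rightarrow> ('v \<Rightarrow> real) \<Rightarrow> (nat \<Rightarrow> 'v) \<Rightarrow> bool" where
  "schauder_basis smul X nrm x \<longleftrightarrow>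
    range x \<subseteq> X \<and> (\<forall>f\<in>X. \<exists>!a. is_expansion smul nrm x f a)"

definition normalized :: "('v \<Rightarrow> real) \<Rightarrow> (nat \<Rightarrow> 'v) \<Rightarrow> bool" where
  "normalized nrm x \<longleftrightarrow> (\<forall>n. nrm (x n) = 1)"

text \<open>\<open>coord smul nrm x f n\<close> is \<open>x\<^sub>n\<^sup>*(f)\<close>; meaningful for a Schauder basis \<open>x\<close> of \<open>X\<close> and \<open>f \<in> X\<close>.\<close>

definition coord ::
  "('k \<Rightarrow> 'v::ab_group_add \<Rightarrow> 'v) \<Rightarrow> ('v \<Rightarrow> real) \<Rightarrow> (nat \<Rightarrow> 'v) \<Rightarrow> 'v \<Rightarrow> nat \<Rightarrow> 'k" where
  "coord smul nrm x f = (THE a. is_expansion smul nrm x f a)"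

definition coord_proj ::
  "('k \<Rightarrow> 'v::ab_group_add \<Rightarrow> 'v) \<Rightarrow> ('v \<Rightarrow> real) \<Rightarrow> (nat \<Rightarrow> 'v) \<Rightarrow> nat set \<Rightarrow> 'v \<Rightarrow> 'v" where
  "coord_proj smul nrm x A f = lin_comb smul x (coord smul nrm x f) A"

text \<open>Unlike the library's \<^const>\<open>sgn\<close>, the sign of \<open>0\<close> is \<open>1\<close>.\<close>

definition unit_sign :: "'k::real_normed_field \<Rightarrow> 'k" where
  "unit_sign c = (if c = 0 then 1 else c / of_real (norm c))"

definition osc ::
  "('k::real_normed_field \<Rightarrow> 'v::ab_group_add \<Rightarrow> 'v) \<Rightarrow> ('v \<Rightarrow> real) \<Rightarrow> (nat \<Rightarrow> 'v) \<Rightarrow> 'v \<Rightarrow> nat set \<Rightarrow> ereal" where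
  "osc smul nrm x f A =
    (let M = Max ((\<lambda>n. norm (coord smul nrm x f n)) ` A);
         m = Min ((\<lambda>n. norm (coord smul nrm x f n)) ` A)
     in if m \<noteq> 0 then ereal (M / m) else if M = 0 then 1 else \<infinity>)"

definition greedy_set ::
  "('k::real_normed_field \<Rightarrow> 'v::ab_group_add \<Rightarrow> 'v) \<Rightarrow> ('v \<Rightarrow> real) \<Rightarrow> (nat \<Rightarrow> 'v) \<Rightarrow> 'v \<Rightarrow> nat set \<Rightarrow> bool" where
  "greedy_set smul nrm x f A \<longleftrightarrow> finite A \<and>
    (\<forall>n\<in>A. \<forall>k\<in>-A. norm (coord smul nrm x f k) \<le> norm (coord smul nrm x f n))"

definition QGLC ::
  "('k::real_normed_field \<Rightarrow> 'v::ab_group_add \<Rightarrow> 'v) \<Rightarrow> 'v set \<Rightarrow> ('v \<Rightarrow> real) \<Rightarrow> (nat \<Rightarrow> 'v) \<Rightarrow> bool" where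
  "QGLC smul X nrm x \<longleftrightarrow>
    (\<exists>C. \<forall>f\<in>X. \<forall>A. A \<noteq> {} \<longrightarrow> greedy_set smul nrm x f A \<longrightarrow> osc smul nrm x f A = 1 \<longrightarrow>
      nrm (coord_proj smul nrm x A f) \<le> C * nrm f)"

definition truncation_quasi_greedy ::
  "('k::real_normed_field \<Rightarrow> 'v::ab_group_add \<Rightarrow> 'v) \<Rightarrow> 'v set \<Rightarrow> ('v \<Rightarrow> real) \<Rightarrow> (nat \<Rightarrow> 'v) \<Rightarrow> bool" where
  "truncation_quasi_greedy smul X nrm x \<longleftrightarrow>
    (\<exists>C. \<forall>f\<in>X. \<forall>A. A \<noteq> {} \<longrightarrow> greedy_set smul nrm x f A \<longrightarrow>
      Min ((\<lambda>n. norm (coord smul nrm x f n)) ` A) *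
        nrm (lin_comb smul x (\<lambda>n. unit_sign (coord smul nrm x f n)) A) \<le> C * nrm f)"

definition LPU ::
  "('k::real_normed_field \<Rightarrow> 'v::ab_group_add \<Rightarrow> 'v) \<Rightarrow> ('v \<Rightarrow> real) \<Rightarrow> (nat \<Rightarrow> 'v) \<Rightarrow> bool" where
  "LPU smul nrm x \<longleftrightarrow>
    (\<exists>C. \<forall>A a b. finite A \<longrightarrow> (SUP n\<in>A. norm (b n)) \<le> (INF n\<in>A. norm (a n)) \<longrightarrow>
      nrm (lin_comb smul x b A) \<le> C * nrm (lin_comb smul x a A))"

definition LUCC ::
  "('k::real_normed_field \<Rightarrow> 'v::ab_group_add \<Rightarrow> 'v) \<Rightarrow> ('v \<Rightarrow> real) \<Rightarrow> (nat \<Rightarrow> 'v) \<Rightarrow> bool" where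
  "LUCC smul nrm x \<longleftrightarrow>
    (\<exists>C. \<forall>A a b. finite A \<longrightarrow> (\<forall>n\<in>A. norm (b n) = 1 \<and> a n / b n \<in> of_real ` {1..}) \<longrightarrow>
      nrm (lin_comb smul x b A) \<le> C * nrm (lin_comb smul x a A))"

definition democratic :: "('v::ab_group_add \<Rightarrow> real) \<Rightarrow> (nat \<Rightarrow> 'v) \<Rightarrow> bool" where
  "democratic nrm x \<longleftrightarrow>
    (\<exists>C. \<forall>A B. finite A \<longrightarrow> finite B \<longrightarrow> card A \<le> card B \<longrightarrow>
      nrm (\<Sum>n\<in>A. x n) \<le> C * nrm (\<Sum>n\<in>B. x n))"

text \<open>For a normalized basis the set below is bounded above by \<open>m\<close>, so its supremum in
  \<^typ>\<open>real\<close> is the genuine one.\<close>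

definition fundamental_fun ::
  "('k::real_normed_field \<Rightarrow> 'v::ab_group_add \<Rightarrow> 'v) \<Rightarrow> ('v \<Rightarrow> real) \<Rightarrow> (nat \<Rightarrow> 'v) \<Rightarrow> nat \<Rightarrow> real" where
  "fundamental_fun smul nrm x m =
    Sup {nrm (lin_comb smul x \<epsilon> A) | \<epsilon> A. finite A \<and> card A \<le> m \<and> (\<forall>n\<in>A. norm (\<epsilon> n) = 1)}"

end

theory Submission
  imports Defs
begin

text \<open>
  Sequences \<open>h = u + F w\<close> with \<open>u\<close> in weak \<open>\<ell>\<^sub>p\<close> (normed, so that \<open>p = 1\<close> gives \<open>\<ell>\<^sub>1\<close>) and \<open>w\<close> of
  bounded variation carry a quotient norm; the space is the closure of the finitely supported ones.
  Here \<open>F\<close> is a fixed weight, distributed along dyadic blocks like a ruler sequence: sorted, it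
  decays within a block first slower and then faster than \<open>n powr (- 1 / p)\<close>. Truncations of \<open>F\<close> have
  norm at most 1 although the weak \<open>\<ell>\<^sub>p\<close> norm of \<open>F\<close> is infinite, which refutes truncation
  quasi-greediness. Conversely, both remaining lower estimates say that a sequence \<open>h\<close> of modulus
  (at least) 1 on \<open>A\<close> has norm at least \<open>c * card A powr (1 / p)\<close>, either if \<open>h\<close> is bounded by 1
  and has modulus exactly 1 on \<open>A\<close>, or if \<open>h\<close> vanishes off \<open>A\<close>. If \<open>F w\<close> approximates such an \<open>h\<close>
  near \<open>n\<close>, then at nearby positions, where \<open>w\<close> is almost unchanged, \<open>F\<close> is twice as large (first
  case) or smaller by a definite factor (second case), so \<open>F w\<close> misses \<open>h\<close> there; and the places
  where \<open>w\<close> does oscillate are few because the variation of \<open>w\<close> is bounded.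
\<close>

section \<open>The dyadic weight\<close>

abbreviation val2 :: "nat \<Rightarrow> nat" where
  "val2 n \<equiv> multiplicity 2 n"

text \<open>Among the n between 2^L and 2^(L+1), about t = 2^(L-v) satisfy
  \<open>val2 n \<ge> v\<close>. At \<open>val2 n = v\<close> the two terms are about (2^L
  t)^(-1/(8p)) and 2^L / t^3, so they cross near t = 2^(L/3). The first term makes the sorted block
  exceed t^(-1/p) there, the second makes the tail of the block summable. Division by zero gives
  weight 0 at index 0.\<close>

definition weight :: "real \<Rightarrow> nat \<Rightarrow> real" where
  "weight p n = min ((2 ^ val2 n / real n ^ 2) powr (1 / (8 * p))) (8 ^ val2 n / real n ^ 2)"

lemma pow_val2_le: "n > 0 \<Longrightarrow> 2 ^ val2 n \<le> n"
  by (simp add: dvd_imp_le multiplicity_dvd)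

lemma weight_0 [simp]: "weight p 0 = 0"
  by (simp add: weight_def)

lemma weight_nonneg [simp]: "0 \<le> weight p n"
  by (simp add: weight_def)

text \<open>Since \<open>2 ^ val2 n \<le> n\<close>, the base of the first term is at most
  \<open>1 / 2 ^ val2 n\<close>. This geometric decay in \<open>val2 n\<close> is what makes sums
  over nested cells converge.\<close>

lemma weight_le_val2:
  assumes "1 \<le> p"
  shows "weight p n \<le> (2 powr (- 1 / (8 * p))) ^ val2 n"
proof (cases "n = 0")
  case False
  have le: "2 ^ val2 n \<le> real n"
    using pow_val2_le[of n] False by (metis neq0_conv of_nat_le_iff of_nat_numeral of_nat_power)
  have "2 ^ val2 n * 2 ^ val2 n \<le> real n ^ 2"
    unfolding power2_eq_square using le by (intro mult_mono) auto
  then have "2 ^ val2 n / real n ^ 2 \<le> 1 / 2 ^ val2 n"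
    using False by (simp add: field_simps)
  then have "(2 ^ val2 n / real n ^ 2) powr (1 / (8 * p)) \<le> (1 / 2 ^ val2 n) powr (1 / (8 * p))"
    using assms by (intro powr_mono2) auto
  also have "\<dots> = (2 powr (- 1 / (8 * p))) ^ val2 n"
    by (simp add: powr_realpow[symmetric] powr_powr powr_minus_divide[symmetric])
  finally show ?thesis by (simp add: weight_def)
qed simp

lemma weight_le_1: "1 \<le> p \<Longrightarrow> weight p n \<le> 1"
proof -
  assume p: "1 \<le> p"
  have "2 powr (- 1 / (8 * p)) \<le> 2 powr 0"
    using p by (intro powr_mono) auto
  then have "(2 powr (- 1 / (8 * p))) ^ val2 n \<le> 1"
    by (intro power_le_one) auto
  with weight_le_val2[OF p, of n] show ?thesis by simp
qed

text \<open>The base of the first term is at most 1/n, so the weight tends to 0.\<close>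

lemma finite_weight_ge:
  assumes "1 \<le> p" "c > 0"
  shows "finite {n. c \<le> weight p n}"
proof -
  have "n \<le> nat \<lceil>(1 / c) powr (8 * p)\<rceil>" if "c \<le> weight p n" for n
  proof (cases "n = 0")
    case False
    have le: "2 ^ val2 n \<le> real n"
      using pow_val2_le[of n] False by (metis neq0_conv of_nat_le_iff of_nat_numeral of_nat_power)
    have "c \<le> (2 ^ val2 n / real n ^ 2) powr (1 / (8 * p))"
      using that by (simp add: weight_def)
    also have "\<dots> \<le> (1 / real n) powr (1 / (8 * p))"
      using assms le False by (intro powr_mono2) (auto simp: field_simps power2_eq_square)
    finally have "c powr (8 * p) \<le> ((1 / real n) powr (1 / (8 * p))) powr (8 * p)"
      using assms by (intro powr_mono2) auto
    also have "\<dots> = 1 / real n"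
      using assms by (simp add: powr_powr)
    finally have "real n \<le> (1 / c) powr (8 * p)"
      using assms False by (simp add: powr_divide field_simps)
    then show ?thesis by linarith
  qed simp
  then show ?thesis
    by (intro finite_subset[OF _ finite_atMost]) blast
qed

text \<open>Raising \<open>val2\<close> by i while at most doubling the index multiplies the first
  base by at least 2^(i-2). Its power \<open>1 / (8 * p)\<close> is at least 2 once i - 2 \<ge> 8p.
  The second term gains 8^i / 4, which is more than enough.\<close>

lemma weight_ancestor:
  assumes "1 \<le> p" "n > 0" "m > 0" "val2 m = val2 n + i" "m \<le> 2 * n" "8 * p + 2 \<le> real i"
  shows "2 * weight p n \<le> weight p m"
proof -
  define a where "a = 1 / (8 * p)"
  have a: "a > 0" using assms by (simp add: a_def)
  have i2: "i \<ge> 2" using assms by linarith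
  have m2: "real m ^ 2 \<le> 4 * real n ^ 2"
  proof -
    have "real m ^ 2 \<le> (2 * real n) ^ 2"
      using assms by (intro power_mono) auto
    then show ?thesis by (simp add: power_mult_distrib)
  qed
  have "1 / (4 * real n ^ 2) \<le> 1 / real m ^ 2"
    using m2 assms by (intro divide_left_mono) auto
  then have q: "c / (4 * real n ^ 2) \<le> c / real m ^ 2" if "c \<ge> 0" for c :: real
    using that by (metis mult.right_neutral mult_left_mono times_divide_eq_right)
  have split: "2 ^ val2 m = 4 * (2 ^ (i - 2) * 2 ^ val2 n :: real)"
  proof -
    obtain j where "i = 2 + j" using i2 le_Suc_ex by blast
    then show ?thesis by (simp add: assms(4) power_add)
  qed
  have 1: "2 * (2 ^ val2 n / real n ^ 2) powr a \<le> (2 ^ val2 m / real m ^ 2) powr a"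
  proof -
    have "2 powr 1 \<le> 2 powr (real (i - 2) * a)"
      using assms i2 by (intro powr_mono) (auto simp: a_def of_nat_diff field_simps)
    also have "\<dots> = (2 ^ (i - 2)) powr a"
      by (simp add: powr_realpow[symmetric] powr_powr)
    finally have "2 * (2 ^ val2 n / real n ^ 2) powr a \<le> (2 ^ (i - 2)) powr a * (2 ^ val2 n / real n ^ 2) powr a"
      by (intro mult_right_mono) auto
    also have "\<dots> = (2 ^ (i - 2) * (2 ^ val2 n / real n ^ 2)) powr a"
      by (simp only: powr_mult)
    also have "\<dots> = (2 ^ val2 m / (4 * real n ^ 2)) powr a"
      by (simp add: split)
    also have "\<dots> \<le> (2 ^ val2 m / real m ^ 2) powr a"
      using a q by (intro powr_mono2) auto
    finally show ?thesis .
  qed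
  have "(8::real) ^ 1 \<le> 8 ^ i" using i2 by (intro power_increasing) auto
  then have "2 * (8 ^ val2 n / real n ^ 2) \<le> 8 ^ i / 4 * (8 ^ val2 n / real n ^ 2)"
    by (intro mult_right_mono) auto
  also have "\<dots> = 8 ^ val2 m / (4 * real n ^ 2)"
    by (simp add: assms(4) power_add)
  also have "\<dots> \<le> 8 ^ val2 m / real m ^ 2" by (rule q) simp
  finally have 2: "2 * (8 ^ val2 n / real n ^ 2) \<le> 8 ^ val2 m / real m ^ 2" .
  show ?thesis
    using 1 2 unfolding weight_def a_def[symmetric] by (auto simp: min_def)
qed

text \<open>Moving right only decreases both terms, and lowering \<open>val2\<close> by k costs the
  first term exactly the stated factor and the second one even 8^k.\<close>

lemma weight_descendant_le:
  assumes "1 \<le> p" "n > 0" "val2 n = val2 m + k" "n \<le> m"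
  shows "weight p m \<le> 2 powr (- real k / (8 * p)) * weight p n"
proof -
  define a where "a = 1 / (8 * p)"
  have a: "0 < a" "a \<le> 1" using assms by (simp_all add: a_def)
  have "1 / real m ^ 2 \<le> 1 / real n ^ 2"
    using assms by (intro divide_left_mono power_mono) auto
  then have q: "c / real m ^ 2 \<le> c / real n ^ 2" if "c \<ge> 0" for c :: real
    using that by (metis mult.right_neutral mult_left_mono times_divide_eq_right)
  have "(2 ^ val2 m / real m ^ 2) powr a \<le> (2 ^ val2 m / real n ^ 2) powr a"
    using a q by (intro powr_mono2) auto
  also have "\<dots> = (1 / 2 ^ k * (2 ^ val2 n / real n ^ 2)) powr a"
    by (simp add: assms(3) power_add)
  also have "\<dots> = 2 powr (- real k * a) * (2 ^ val2 n / real n ^ 2) powr a"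
    by (simp only: powr_mult) (simp add: powr_realpow[symmetric] powr_powr powr_minus_divide[symmetric])
  finally have 1: "(2 ^ val2 m / real m ^ 2) powr a \<le> 2 powr (- real k * a) * (2 ^ val2 n / real n ^ 2) powr a" .
  have "8 ^ val2 m / real m ^ 2 \<le> 8 ^ val2 m / real n ^ 2" by (rule q) simp
  also have "\<dots> = 1 / 8 ^ k * (8 ^ val2 n / real n ^ 2)"
    by (simp add: assms(3) power_add)
  also have "\<dots> \<le> 2 powr (- real k * a) * (8 ^ val2 n / real n ^ 2)"
  proof (intro mult_right_mono)
    have "1 / 8 ^ k \<le> (1 / 2 ^ k :: real)"
      by (simp add: divide_simps power_mono)
    also have "\<dots> = 2 powr (- real k)"
      by (simp add: powr_realpow powr_minus_divide)
    also have "\<dots> \<le> 2 powr (- real k * a)"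
      using a by (intro powr_mono) (auto simp: mult_left_le)
    finally show "1 / 8 ^ k \<le> 2 powr (- real k * a)" .
  qed auto
  finally have 2: "8 ^ val2 m / real m ^ 2 \<le> 2 powr (- real k * a) * (8 ^ val2 n / real n ^ 2)" .
  have "2 powr (- real k * a) * weight p n = min (2 powr (- real k * a) * (2 ^ val2 n / real n ^ 2) powr a)
      (2 powr (- real k * a) * (8 ^ val2 n / real n ^ 2))"
    unfolding weight_def a_def[symmetric] by (simp add: min_mult_distrib_left)
  then have "weight p m \<le> 2 powr (- real k * a) * weight p n"
    using 1 2 unfolding weight_def[of p m] a_def[symmetric] by linarith
  then show ?thesis by (simp add: a_def)
qed

text \<open>The worst loss is that of the second term: 8^k from \<open>val2\<close> and 4 from
  doubling the index. The first term loses at most a power with exponent at most 1 of 4 *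
  2^k.\<close>

lemma weight_descendant_ge:
  assumes "1 \<le> p" "m > 0" "val2 n = val2 m + k" "m \<le> 2 * n"
  shows "weight p n / (4 * 8 ^ k) \<le> weight p m"
proof -
  define a where "a = 1 / (8 * p)"
  have a: "0 < a" "a \<le> 1" using assms by (simp_all add: a_def)
  have m2: "real m ^ 2 \<le> 4 * real n ^ 2"
  proof -
    have "real m ^ 2 \<le> (2 * real n) ^ 2"
      using assms by (intro power_mono) auto
    then show ?thesis by (simp add: power_mult_distrib)
  qed
  have "n > 0" using assms by simp
  have "1 / (4 * real n ^ 2) \<le> 1 / real m ^ 2"
    using m2 assms by (intro divide_left_mono) auto
  then have q: "c / (4 * real n ^ 2) \<le> c / real m ^ 2" if "c \<ge> 0" for c :: real
    using that by (metis mult.right_neutral mult_left_mono times_divide_eq_right)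
  have "(2 ^ val2 n / real n ^ 2) powr a / (4 * 8 ^ k) \<le> (1 / (4 * 2 ^ k)) powr a * (2 ^ val2 n / real n ^ 2) powr a"
  proof -
    have "1 / (4 * 8 ^ k) \<le> (1 / (4 * 2 ^ k) :: real)"
      by (simp add: divide_simps power_mono)
    also have "\<dots> = (1 / (4 * 2 ^ k)) powr 1" by simp
    also have "\<dots> \<le> (1 / (4 * 2 ^ k)) powr a"
    proof (rule powr_mono')
      have "(1::real) \<le> 2 ^ k" by (rule one_le_power) simp
      then have "(1::real) \<le> 4 * 2 ^ k" by linarith
      then show "1 / (4 * 2 ^ k) \<le> (1::real)" by simp
    qed (use a in auto)
    finally have "1 / (4 * 8 ^ k) * (2 ^ val2 n / real n ^ 2) powr a \<le> (1 / (4 * 2 ^ k)) powr a * (2 ^ val2 n / real n ^ 2) powr a"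
      by (intro mult_right_mono) auto
    then show ?thesis by simp
  qed
  also have "\<dots> = (2 ^ val2 m / (4 * real n ^ 2)) powr a"
    by (simp add: powr_mult[symmetric] assms(3) power_add field_simps)
  also have "\<dots> \<le> (2 ^ val2 m / real m ^ 2) powr a"
    using a q by (intro powr_mono2) auto
  finally have 1: "(2 ^ val2 n / real n ^ 2) powr a / (4 * 8 ^ k) \<le> (2 ^ val2 m / real m ^ 2) powr a" .
  have "8 ^ val2 n / real n ^ 2 / (4 * 8 ^ k) = 8 ^ val2 m / (4 * real n ^ 2)"
    by (simp add: assms(3) power_add)
  also have "\<dots> \<le> 8 ^ val2 m / real m ^ 2" by (rule q) simp
  finally have 2: "8 ^ val2 n / real n ^ 2 / (4 * 8 ^ k) \<le> 8 ^ val2 m / real m ^ 2" .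
  have "weight p n / (4 * 8 ^ k) = min ((2 ^ val2 n / real n ^ 2) powr a / (4 * 8 ^ k))
      (8 ^ val2 n / real n ^ 2 / (4 * 8 ^ k))"
    unfolding weight_def a_def[symmetric] by (simp add: min_divide_distrib_right)
  then show ?thesis
    using 1 2 unfolding weight_def[of p m] a_def[symmetric] by linarith
qed

section \<open>Counting small oscillations\<close>

text \<open>For p > 1 this is the averaged form of the weak l_p quasi-norm, chosen because it is
  subadditive. For p = 1 the exponent is 0 and the l_1 norm results.\<close>

definition weak_bound :: "real \<Rightarrow> (nat \<Rightarrow> 'k::real_normed_vector) \<Rightarrow> real \<Rightarrow> bool" where
  "weak_bound p u \<alpha> \<longleftrightarrow>
    (\<forall>B. finite B \<longrightarrow> (\<Sum>n\<in>B. norm (u n)) \<le> \<alpha> * real (card B) powr (1 - 1 / p))"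

text \<open>Adding \<open>norm (w N)\<close> to the variation up to N accounts for the jump to 0
  after N, so that truncation never increases the bound.\<close>

definition bv_bound :: "(nat \<Rightarrow> 'k::real_normed_vector) \<Rightarrow> real \<Rightarrow> bool" where
  "bv_bound w \<beta> \<longleftrightarrow> (\<forall>N. norm (w N) + (\<Sum>k<N. norm (w k - w (Suc k))) \<le> \<beta>)"

lemma weak_boundD: "weak_bound p u \<alpha> \<Longrightarrow> norm (u n) \<le> \<alpha>"
  unfolding weak_bound_def by (drule spec[of _ "{n}"]) simp

lemma weak_bound_nonneg: "weak_bound p u \<alpha> \<Longrightarrow> 0 \<le> \<alpha>"
  using weak_boundD[of p u \<alpha> 0] norm_ge_zero order_trans by blast

text \<open>A Chebyshev estimate: \<tau> |B| \<le> \<alpha> |B|^(1-1/p), and dividing leaves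
  |B|^(1/p) \<le> \<alpha> / \<tau>.\<close>

lemma card_le_weak_bound:
  assumes "1 \<le> p" "weak_bound p u \<alpha>" "finite B" "\<tau> > 0" "\<And>n. n \<in> B \<Longrightarrow> \<tau> \<le> norm (u n)"
  shows "real (card B) \<le> (\<alpha> / \<tau>) powr p"
proof (cases "B = {}")
  case False
  then have c: "real (card B) > 0" using assms by (simp add: card_gt_0_iff)
  have "real (card B) * \<tau> \<le> (\<Sum>n\<in>B. norm (u n))"
    using sum_mono[of B "\<lambda>_. \<tau>" "\<lambda>n. norm (u n)"] assms by simp
  also have "\<dots> \<le> \<alpha> * real (card B) powr (1 - 1 / p)"
    using assms by (simp add: weak_bound_def)
  also have "\<dots> = \<alpha> * (real (card B) / real (card B) powr (1 / p))"
    using c by (simp add: powr_diff)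
  finally have "\<tau> \<le> \<alpha> / real (card B) powr (1 / p)"
    using c by (simp add: field_simps)
  moreover have "real (card B) powr (1 / p) > 0" using c by simp
  ultimately have "real (card B) powr (1 / p) \<le> \<alpha> / \<tau>"
    using assms by (simp add: field_simps del: powr_gt_zero)
  then have "(real (card B) powr (1 / p)) powr p \<le> (\<alpha> / \<tau>) powr p"
    using assms by (intro powr_mono2) auto
  then show ?thesis using assms c by (simp add: powr_powr)
qed simp

lemma bv_boundD: "bv_bound w \<beta> \<Longrightarrow> norm (w n) \<le> \<beta>"
  unfolding bv_bound_def
  by (drule spec[of _ n]) (smt (verit) norm_ge_zero sum_nonneg)

lemma bv_bound_nonneg: "bv_bound w \<beta> \<Longrightarrow> 0 \<le> \<beta>"
  using bv_boundD[of w \<beta> 0] norm_ge_zero order_trans by blast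

lemma bv_bound_sum:
  assumes "bv_bound w \<beta>"
  shows "(\<Sum>k<N. norm (w k - w (Suc k))) \<le> \<beta>"
  using assms unfolding bv_bound_def by (smt (verit) norm_ge_zero)

section \<open>Summing the weight over the dyadic cells through a point\<close>

lemma sum_geometric_fibres_le:
  fixes g :: "'a \<Rightarrow> nat"
  assumes "finite S" "0 \<le> q" "q < 1" "\<And>v. card {n \<in> S. g n = v} \<le> K"
  shows "(\<Sum>n\<in>S. q ^ g n) \<le> real K / (1 - q)"
proof -
  have "(\<Sum>n\<in>S. q ^ g n) = (\<Sum>v\<in>g ` S. \<Sum>n\<in>{n \<in> S. g n = v}. q ^ g n)"
    using assms by (intro sum.image_gen)
  also have "\<dots> = (\<Sum>v\<in>g ` S. real (card {n \<in> S. g n = v}) * q ^ v)"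
    by (intro sum.cong) auto
  also have "\<dots> \<le> (\<Sum>v\<in>g ` S. real K * q ^ v)"
    using assms by (intro sum_mono mult_right_mono) auto
  also have "\<dots> = real K * (\<Sum>v\<in>g ` S. q ^ v)"
    by (simp add: sum_distrib_left)
  also have "\<dots> \<le> real K * (1 / (1 - q))"
  proof (intro mult_left_mono)
    have "(\<Sum>v\<in>g ` S. q ^ v) \<le> (\<Sum>v. q ^ v)"
      using assms by (intro sum_le_suminf summable_geometric) auto
    then show "(\<Sum>v\<in>g ` S. q ^ v) \<le> 1 / (1 - q)"
      using assms by (simp add: suminf_geometric)
  qed simp
  finally show ?thesis by simp
qed

text \<open>The cells \<open>{l. l div 2 ^ (val2 n + s) = n div 2 ^ (val2 n + s)}\<close> below are the dyadic intervals
  around \<open>n\<close>, scaled by \<open>val2 n\<close> so that few cells of each scale contain a given point.\<close>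

lemma card_val2_cell_le:
  "card {n \<in> S. val2 n = v \<and> n div 2 ^ (v + s) = q} \<le> 2 ^ s"
proof -
  let ?T = "{n \<in> S. val2 n = v \<and> n div 2 ^ (v + s) = q}"
  \<comment> \<open>Each n in the set is a multiple of 2^v, hence recovered from its quotient; the
    quotients all lie in one window of length 2^s.\<close>
  have "inj_on (\<lambda>n. n div 2 ^ v) ?T"
  proof (rule inj_onI)
    fix m n assume "m \<in> ?T" "n \<in> ?T" "m div 2 ^ v = n div 2 ^ v"
    moreover have "2 ^ v dvd m" "2 ^ v dvd n"
      using calculation multiplicity_dvd[of 2 m] multiplicity_dvd[of 2 n] by auto
    ultimately show "m = n" by (metis dvd_div_mult_self)
  qed
  moreover have "(\<lambda>n. n div 2 ^ v) ` ?T \<subseteq> {q * 2 ^ s..<q * 2 ^ s + 2 ^ s}"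
  proof safe
    fix n
    have eq: "n div 2 ^ (val2 n + s) = n div 2 ^ val2 n div 2 ^ s"
      by (simp add: power_add div_mult2_eq)
    show "n div 2 ^ val2 n \<in> {n div 2 ^ (val2 n + s) * 2 ^ s..<n div 2 ^ (val2 n + s) * 2 ^ s + 2 ^ s}"
      unfolding eq using dividend_less_div_times[of "2 ^ s" "n div 2 ^ val2 n"]
      by (simp add: add.commute)
  qed
  ultimately have "card ?T \<le> card {q * 2 ^ s..<q * 2 ^ s + 2 ^ s}"
    by (intro card_inj_on_le) auto
  then show ?thesis by simp
qed

text \<open>For each value of \<open>val2 n\<close> at most 2^s points n have k in their cell, and
  their weights decay geometrically in that value. The bound is uniform in k and S.\<close>

lemma sum_weight_cell:
  assumes "1 \<le> p"
  obtains M where "M \<ge> 0"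
    "\<And>S k. finite S \<Longrightarrow> (\<Sum>n | n \<in> S \<and> n div 2 ^ (val2 n + s) = k div 2 ^ (val2 n + s). weight p n) \<le> M"
proof
  define q :: real where "q = 2 powr (- 1 / (8 * p))"
  have "q < 2 powr 0" unfolding q_def using assms by (intro powr_less_mono) auto
  then have q: "0 \<le> q" "q < 1" by (auto simp: q_def)
  then show "0 \<le> real (2 ^ s) / (1 - q)" by simp
  fix S :: "nat set" and k assume S: "finite S"
  let ?T = "{n \<in> S. n div 2 ^ (val2 n + s) = k div 2 ^ (val2 n + s)}"
  have "card {n \<in> ?T. val2 n = v} \<le> 2 ^ s" for v
  proof -
    have "{n \<in> ?T. val2 n = v} = {n \<in> S. val2 n = v \<and> n div 2 ^ (v + s) = k div 2 ^ (v + s)}"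
      by auto
    then show ?thesis using card_val2_cell_le by simp
  qed
  then have "(\<Sum>n\<in>?T. q ^ val2 n) \<le> real (2 ^ s) / (1 - q)"
    using S q by (intro sum_geometric_fibres_le) auto
  moreover have "(\<Sum>n\<in>?T. weight p n) \<le> (\<Sum>n\<in>?T. q ^ val2 n)"
    unfolding q_def using weight_le_val2[OF assms] by (intro sum_mono) auto
  ultimately show "(\<Sum>n\<in>?T. weight p n) \<le> real (2 ^ s) / (1 - q)" by linarith
qed

lemma norm_diff_le_variation:
  fixes w :: "nat \<Rightarrow> 'k::real_normed_vector"
  assumes "m \<le> n"
  shows "norm (w n - w m) \<le> (\<Sum>k=m..<n. norm (w k - w (Suc k)))"
proof -
  have "w m - w n = (\<Sum>k=m..<n. w k - w (Suc k))"
    using sum_Suc_diff'[OF assms, of "\<lambda>k. - w k"] by simp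
  then show ?thesis by (metis norm_minus_commute norm_sum)
qed

text \<open>Double counting: every n in S charges its weight to each increment of w inside its cell,
  and collects at least \<kappa>. An increment at k is charged only by points whose cell contains k,
  and these have total weight at most M. The total is thus at most M times the variation.\<close>

lemma card_oscillation_le:
  assumes p: "1 \<le> p"
  obtains M where "M \<ge> 0"
    "\<And>(w :: nat \<Rightarrow> 'k::real_normed_vector) \<beta> S \<kappa> l. bv_bound w \<beta> \<Longrightarrow> finite S \<Longrightarrow>
      (\<And>n. n \<in> S \<Longrightarrow> l n div 2 ^ (val2 n + s) = n div 2 ^ (val2 n + s)) \<Longrightarrow>
      (\<And>n. n \<in> S \<Longrightarrow> \<kappa> \<le> weight p n * norm (w (l n) - w n)) \<Longrightarrow>
      \<kappa> * real (card S) \<le> M * \<beta>"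
proof -
  obtain M where M: "M \<ge> 0"
    "\<And>S k. finite S \<Longrightarrow> (\<Sum>n | n \<in> S \<and> n div 2 ^ (val2 n + s) = k div 2 ^ (val2 n + s). weight p n) \<le> M"
    using sum_weight_cell[OF p, of s] by blast
  show thesis
  proof (rule that[OF M(1)])
    fix w :: "nat \<Rightarrow> 'k" and \<beta> S \<kappa> and l :: "nat \<Rightarrow> nat"
    assume w: "bv_bound w \<beta>" and S: "finite S"
      and cell: "\<And>n. n \<in> S \<Longrightarrow> l n div 2 ^ (val2 n + s) = n div 2 ^ (val2 n + s)"
      and osc: "\<And>n. n \<in> S \<Longrightarrow> \<kappa> \<le> weight p n * norm (w (l n) - w n)"
    define D where "D k = norm (w k - w (Suc k))" for k
    define I where "I n k \<longleftrightarrow> n div 2 ^ (val2 n + s) = k div 2 ^ (val2 n + s)" for n k :: nat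
    obtain N where N: "\<And>n. n \<in> S \<Longrightarrow> n < N \<and> l n < N"
    proof -
      obtain N where "\<forall>n\<in>S \<union> l ` S. n < N"
        using S finite_nat_set_iff_bounded by (metis finite_UnI finite_imageI)
      then show thesis using that by blast
    qed
    have var: "norm (w (l n) - w n) \<le> (\<Sum>k<N. if I n k then D k else 0)" if "n \<in> S" for n
    proof -
      have "norm (w (l n) - w n) \<le> (\<Sum>k=min n (l n)..<max n (l n). D k)"
        using norm_diff_le_variation[of n "l n" w] norm_diff_le_variation[of "l n" n w]
        by (cases "n \<le> l n") (auto simp: D_def min_def max_def norm_minus_commute)
      \<comment> \<open>Cells are intervals containing both n and \<open>l n\<close>, so every k in
        between lies in the same cell.\<close>
      also have "\<dots> = (\<Sum>k=min n (l n)..<max n (l n). if I n k then D k else 0)"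
      proof (rule sum.cong[OF refl])
        fix k assume k: "k \<in> {min n (l n)..<max n (l n)}"
        then have "min n (l n) div 2 ^ (val2 n + s) \<le> k div 2 ^ (val2 n + s)"
          "k div 2 ^ (val2 n + s) \<le> max n (l n) div 2 ^ (val2 n + s)"
          by (auto intro!: div_le_mono)
        then have "I n k"
          using cell[OF that] by (auto simp: I_def min_def max_def split: if_splits)
        then show "D k = (if I n k then D k else 0)" by simp
      qed
      also have "\<dots> \<le> (\<Sum>k<N. if I n k then D k else 0)"
        using N[OF that] by (intro sum_mono2) (auto simp: D_def)
      finally show ?thesis .
    qed
    have "\<kappa> * real (card S) = (\<Sum>n\<in>S. \<kappa>)" by simp
    also have "\<dots> \<le> (\<Sum>n\<in>S. weight p n * (\<Sum>k<N. if I n k then D k else 0))"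
    proof (rule sum_mono)
      fix n assume "n \<in> S"
      then show "\<kappa> \<le> weight p n * (\<Sum>k<N. if I n k then D k else 0)"
        using osc[of n] mult_left_mono[OF var[of n] weight_nonneg[of p n]] by linarith
    qed
    also have "\<dots> = (\<Sum>n\<in>S. \<Sum>k<N. if I n k then D k * weight p n else 0)"
      by (auto simp: sum_distrib_left intro!: sum.cong)
    \<comment> \<open>Exchanging the sums isolates, for each increment, the total weight of the
      points charging it.\<close>
    also have "\<dots> = (\<Sum>k<N. \<Sum>n\<in>S. if I n k then D k * weight p n else 0)"
      by (rule sum.swap)
    also have "\<dots> = (\<Sum>k<N. D k * (\<Sum>n | n \<in> S \<and> I n k. weight p n))"
      using S by (simp add: sum.inter_filter[symmetric] sum_distrib_left)
    also have "\<dots> \<le> (\<Sum>k<N. D k * M)"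
      unfolding I_def using M(2)[OF S] by (intro sum_mono mult_left_mono) (auto simp: D_def)
    also have "\<dots> = M * (\<Sum>k<N. D k)"
      by (simp add: sum_distrib_left mult.commute)
    also have "\<dots> \<le> M * \<beta>"
      using bv_bound_sum[OF w, of N] M(1) by (intro mult_left_mono) (auto simp: D_def)
    finally show "\<kappa> * real (card S) \<le> M * \<beta>" .
  qed
qed

lemma card_le_sum_weight:
  assumes "bv_bound w \<beta>" "(\<Sum>n\<in>S. weight p n) \<le> M" "\<And>n. n \<in> S \<Longrightarrow> \<kappa> \<le> weight p n * norm (w n)"
  shows "\<kappa> * real (card S) \<le> M * \<beta>"
proof -
  have "\<kappa> * real (card S) = (\<Sum>n\<in>S. \<kappa>)" by simp
  also have "\<dots> \<le> (\<Sum>n\<in>S. weight p n * \<beta>)"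
    using assms(3) mult_left_mono[OF bv_boundD[OF assms(1)] weight_nonneg[of p]] 
    by (intro sum_mono) (meson order_trans)
  also have "\<dots> = (\<Sum>n\<in>S. weight p n) * \<beta>"
    by (simp add: sum_distrib_right)
  also have "\<dots> \<le> M * \<beta>"
    using assms bv_bound_nonneg by (intro mult_right_mono) auto
  finally show ?thesis .
qed

text \<open>These are the points too close to 0 to have an ancestor below 2n. Their cells all
  contain 0, so their total weight is bounded.\<close>

lemma card_top_le:
  assumes p: "1 \<le> p"
  obtains M where "M \<ge> 0"
    "\<And>(w :: nat \<Rightarrow> 'k::real_normed_vector) \<beta> S \<kappa>. bv_bound w \<beta> \<Longrightarrow> finite S \<Longrightarrow>
      (\<And>n. n \<in> S \<Longrightarrow> n < 2 ^ (val2 n + s)) \<Longrightarrow>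
      (\<And>n. n \<in> S \<Longrightarrow> \<kappa> \<le> weight p n * norm (w n)) \<Longrightarrow>
      \<kappa> * real (card S) \<le> M * \<beta>"
proof -
  obtain M where M: "M \<ge> 0"
    "\<And>S k. finite S \<Longrightarrow> (\<Sum>n | n \<in> S \<and> n div 2 ^ (val2 n + s) = k div 2 ^ (val2 n + s). weight p n) \<le> M"
    using sum_weight_cell[OF p, of s] by blast
  show thesis
  proof (rule that[OF M(1)])
    fix w :: "nat \<Rightarrow> 'k" and \<beta> S \<kappa>
    assume w: "bv_bound w \<beta>" and S: "finite S" "\<And>n. n \<in> S \<Longrightarrow> n < 2 ^ (val2 n + s)"
      and k: "\<And>n. n \<in> S \<Longrightarrow> \<kappa> \<le> weight p n * norm (w n)"
    have "{n \<in> S. n div 2 ^ (val2 n + s) = 0 div 2 ^ (val2 n + s)} = S"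
      using S(2) by auto
    then have "(\<Sum>n\<in>S. weight p n) \<le> M"
      using M(2)[OF S(1), of 0] by simp
    then show "\<kappa> * real (card S) \<le> M * \<beta>"
      using card_le_sum_weight[OF w] k by blast
  qed
qed

text \<open>These are the points without a descendant s levels down. The second term of the weight
  is at most 8^s / n^2 on them, which is summable.\<close>

lemma card_bottom_le:
  obtains M where "M \<ge> 0"
    "\<And>(w :: nat \<Rightarrow> 'k::real_normed_vector) \<beta> S \<kappa>. bv_bound w \<beta> \<Longrightarrow> finite S \<Longrightarrow>
      (\<And>n. n \<in> S \<Longrightarrow> val2 n < s) \<Longrightarrow>
      (\<And>n. n \<in> S \<Longrightarrow> \<kappa> \<le> weight p n * norm (w n)) \<Longrightarrow>
      \<kappa> * real (card S) \<le> M * \<beta>"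
proof -
  have sm: "summable (\<lambda>n. 8 ^ s * inverse (real n ^ 2))"
    by (intro summable_mult inverse_power_summable) simp
  show thesis
  proof
    show "0 \<le> (\<Sum>n. 8 ^ s * inverse (real n ^ 2))"
      by (intro suminf_nonneg sm) simp
    fix w :: "nat \<Rightarrow> 'k" and \<beta> S \<kappa>
    assume w: "bv_bound w \<beta>" and S: "finite S" "\<And>n. n \<in> S \<Longrightarrow> val2 n < s"
      and k: "\<And>n. n \<in> S \<Longrightarrow> \<kappa> \<le> weight p n * norm (w n)"
    have "weight p n \<le> 8 ^ s * inverse (real n ^ 2)" if "n \<in> S" for n
    proof -
      have "weight p n \<le> 8 ^ val2 n / real n ^ 2" by (simp add: weight_def)
      also have "\<dots> \<le> 8 ^ s / real n ^ 2"
        using S(2)[OF that] by (intro divide_right_mono power_increasing) auto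
      finally show ?thesis by (simp add: divide_inverse)
    qed
    then have "(\<Sum>n\<in>S. weight p n) \<le> (\<Sum>n\<in>S. 8 ^ s * inverse (real n ^ 2))"
      by (intro sum_mono)
    also have "\<dots> \<le> (\<Sum>n. 8 ^ s * inverse (real n ^ 2))"
      using S by (intro sum_le_suminf sm) auto
    finally show "\<kappa> * real (card S) \<le> (\<Sum>n. 8 ^ s * inverse (real n ^ 2)) * \<beta>"
      using card_le_sum_weight[OF w] k by blast
  qed
qed

section \<open>Ancestors and descendants in the dyadic cells\<close>

lemma val2_odd_multiple: "odd m \<Longrightarrow> val2 (2 ^ e * m) = e"
  by (intro multiplicity_eqI) (auto simp: power_Suc2 simp del: power_Suc)

text \<open>\<open>m\<close> is the midpoint of the dyadic interval of length 2^(val2 n + i + 1)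
  around n, hence an odd multiple of half that length. If n is at least the length, then the left
  endpoint and the half length are each at most n.\<close>

lemma cell_ancestor:
  fixes n i :: nat
  defines "m \<equiv> n div 2 ^ (val2 n + Suc i) * 2 ^ (val2 n + Suc i) + 2 ^ (val2 n + i)"
  shows "val2 m = val2 n + i" "m div 2 ^ (val2 n + Suc i) = n div 2 ^ (val2 n + Suc i)"
    "2 ^ (val2 n + Suc i) \<le> n \<Longrightarrow> m \<le> 2 * n"
proof -
  have "m = 2 ^ (val2 n + i) * (2 * (n div 2 ^ (val2 n + Suc i)) + 1)"
    unfolding m_def by (simp add: algebra_simps)
  then show "val2 m = val2 n + i"
    using val2_odd_multiple[of "2 * (n div 2 ^ (val2 n + Suc i)) + 1" "val2 n + i"]
    by (simp only:) simp
  show "m div 2 ^ (val2 n + Suc i) = n div 2 ^ (val2 n + Suc i)"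
    unfolding m_def by simp
  assume le: "2 ^ (val2 n + Suc i) \<le> n"
  have "n div 2 ^ (val2 n + Suc i) * 2 ^ (val2 n + Suc i) \<le> n"
    by (rule div_times_less_eq_dividend)
  moreover have "(2::nat) ^ (val2 n + i) \<le> 2 ^ (val2 n + Suc i)"
    by (intro power_increasing) auto
  ultimately show "m \<le> 2 * n"
    unfolding m_def using le by linarith
qed

text \<open>An odd multiple of 2^(val2 n - k) smaller than 2^(val2 n) is added to n. This lowers
  \<open>val2\<close> by exactly k, stays in the interval of length 2^(val2 n) starting at n, and
  adds less than n.\<close>

lemma cell_descendant:
  fixes n k r :: nat
  assumes "n > 0" "k \<le> val2 n" "odd r" "r < 2 ^ k" "0 < k"
  defines "m \<equiv> n + r * 2 ^ (val2 n - k)"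
  shows "val2 m + k = val2 n" "m div 2 ^ val2 n = n div 2 ^ val2 n" "m \<le> 2 * n"
proof -
  define v where "v = val2 n"
  have "2 ^ v dvd n" unfolding v_def by (rule multiplicity_dvd)
  then obtain c where c: "2 ^ v * c = n" by (metis dvd_mult_div_cancel)
  have pk: "2 ^ (v - k) * 2 ^ k = (2::nat) ^ v"
    using assms by (simp add: v_def power_add[symmetric])
  have lt: "r * 2 ^ (v - k) < 2 ^ v"
    unfolding pk[symmetric] using assms by simp
  have m: "m = 2 ^ v * c + r * 2 ^ (v - k)"
    by (simp add: m_def v_def[symmetric] c)
  also have "\<dots> = 2 ^ (v - k) * (2 ^ k * c + r)"
    unfolding pk[symmetric] by (simp add: algebra_simps)
  finally have "val2 m = v - k"
    using val2_odd_multiple[of "2 ^ k * c + r" "v - k"] assms(3,5) by simp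
  then show "val2 m + k = val2 n" using assms(2) by (simp add: v_def)
  have "m div 2 ^ v = c" unfolding m using lt by simp
  moreover have "n div 2 ^ v = c" unfolding c[symmetric] by simp
  ultimately show "m div 2 ^ val2 n = n div 2 ^ val2 n" by (simp add: v_def)
  show "m \<le> 2 * n"
    using lt pow_val2_le[OF assms(1)] unfolding m_def v_def by linarith
qed

section \<open>Lower estimates\<close>

text \<open>On a set where \<open>u\<close> is small, \<open>w n\<close> is about \<open>1 / weight p n\<close>. Then either \<open>w\<close> oscillates
  near \<open>n\<close>, or the perturbation \<open>weight p m * w m\<close> exceeds \<open>1\<close> at the ancestor \<open>m\<close> of \<open>n\<close>,
  where \<open>u\<close> has to compensate it.\<close>

lemma card_le_of_unimodular:
  assumes p: "1 \<le> p"
  obtains C where "C \<ge> 0"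
    "\<And>(u :: nat \<Rightarrow> 'k::real_normed_vector) w \<alpha> \<beta> A. weak_bound p u \<alpha> \<Longrightarrow> bv_bound w \<beta> \<Longrightarrow> finite A \<Longrightarrow>
      (\<And>n. n \<in> A \<Longrightarrow> norm (u n + weight p n *\<^sub>R w n) = 1) \<Longrightarrow>
      (\<And>n. norm (u n + weight p n *\<^sub>R w n) \<le> 1) \<Longrightarrow> real (card A) \<le> C * (\<alpha> powr p + \<beta>)"
proof -
  \<comment> \<open>The number of levels that \<open>weight_ancestor\<close> needs to double the
    weight.\<close>
  define i where "i = nat \<lceil>8 * p + 2\<rceil>"
  have i: "8 * p + 2 \<le> real i" unfolding i_def by linarith
  define s where "s = Suc i"
  obtain M1 where M1: "M1 \<ge> 0"
    "\<And>(w :: nat \<Rightarrow> 'k) \<beta> S \<kappa> l. bv_bound w \<beta> \<Longrightarrow> finite S \<Longrightarrow>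
      (\<And>n. n \<in> S \<Longrightarrow> l n div 2 ^ (val2 n + s) = n div 2 ^ (val2 n + s)) \<Longrightarrow>
      (\<And>n. n \<in> S \<Longrightarrow> \<kappa> \<le> weight p n * norm (w (l n) - w n)) \<Longrightarrow>
      \<kappa> * real (card S) \<le> M1 * \<beta>"
    using card_oscillation_le[where 'k = 'k, OF p, of s] by blast
  obtain M2 where M2: "M2 \<ge> 0"
    "\<And>(w :: nat \<Rightarrow> 'k) \<beta> S \<kappa>. bv_bound w \<beta> \<Longrightarrow> finite S \<Longrightarrow>
      (\<And>n. n \<in> S \<Longrightarrow> n < 2 ^ (val2 n + s)) \<Longrightarrow>
      (\<And>n. n \<in> S \<Longrightarrow> \<kappa> \<le> weight p n * norm (w n)) \<Longrightarrow>
      \<kappa> * real (card S) \<le> M2 * \<beta>"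
    using card_top_le[where 'k = 'k, OF p, of s] by blast
  define C where "C = 4 powr p + 2 ^ s * 8 powr p + 16 / 3 * M1 + 4 / 3 * M2"
  show thesis
  proof (rule that[of C])
    show "C \<ge> 0" using M1(1) M2(1) by (simp add: C_def)
    fix u w :: "nat \<Rightarrow> 'k" and \<alpha> \<beta> A
    assume u: "weak_bound p u \<alpha>" and w: "bv_bound w \<beta>" and A: "finite A"
      and one: "\<And>n. n \<in> A \<Longrightarrow> norm (u n + weight p n *\<^sub>R w n) = 1"
      and le1: "\<And>n. norm (u n + weight p n *\<^sub>R w n) \<le> 1"
    note nn = weak_bound_nonneg[OF u] bv_bound_nonneg[OF w]
    define anc where "anc n = n div 2 ^ (val2 n + Suc i) * 2 ^ (val2 n + Suc i) + 2 ^ (val2 n + i)" for n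
    \<comment> \<open>Four cases: u is large at n, n is too close to 0, w oscillates between n and
      its ancestor, or none of these. The thresholds leave 3/4 - 3/16 = 9/16 in the last case, and
      doubling gives 9/8 > 1.\<close>
    define A1 where "A1 = {n \<in> A. 1 / 4 \<le> norm (u n)}"
    define T where "T = {n \<in> A - A1. n < 2 ^ (val2 n + s)}"
    define Os where "Os = {n \<in> A - A1. 3 / 16 \<le> weight p n * norm (w (anc n) - w n)}"
    define Gd where "Gd = A - A1 - T - Os"
    have fin: "finite A1" "finite T" "finite Os" "finite Gd"
      using A by (auto simp: A1_def T_def Os_def Gd_def)
    have big: "3 / 4 \<le> weight p n * norm (w n)" if "n \<in> A - A1" for n
    proof -
      have "1 \<le> norm (u n) + norm (weight p n *\<^sub>R w n)"
        using one[of n] that norm_triangle_ineq by (metis DiffD1)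
      then show ?thesis using that by (auto simp: A1_def)
    qed
    have 1: "real (card A1) \<le> 4 powr p * \<alpha> powr p"
      using card_le_weak_bound[OF p u fin(1), of "1 / 4"] nn
      by (simp add: A1_def powr_mult mult.commute)
    have 2: "3 / 4 * real (card T) \<le> M2 * \<beta>"
      using M2(2)[OF w fin(2), of "3 / 4"] big by (auto simp: T_def)
    have 3: "3 / 16 * real (card Os) \<le> M1 * \<beta>"
      using M1(2)[OF w fin(3), of anc "3 / 16"] cell_ancestor(2)
      by (auto simp: Os_def anc_def s_def)
    \<comment> \<open>At the ancestor the perturbation has size at least 9/8 while the whole
      sequence has modulus at most 1, so u must cancel 1/8.\<close>
    have 4: "1 / 8 \<le> norm (u (anc n))" if "n \<in> Gd" for n
    proof -
      have n: "n \<in> A - A1" "2 ^ (val2 n + Suc i) \<le> n" "weight p n * norm (w (anc n) - w n) < 3 / 16"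
        using that by (auto simp: Gd_def T_def Os_def s_def)
      have "n > 0" using n(2) by (intro gr0I) simp
      have anc: "val2 (anc n) = val2 n + i" "anc n \<le> 2 * n" "anc n > 0"
        using cell_ancestor(1,3)[of n i] n(2) by (simp_all add: anc_def)
      have wt: "2 * weight p n \<le> weight p (anc n)"
        using weight_ancestor[OF p \<open>n > 0\<close> anc(3) anc(1) anc(2) i] .
      have "norm (w n) \<le> norm (w (anc n) - w n) + norm (w (anc n))"
        using norm_triangle_sub[of "w n" "w (anc n)"] by (simp add: norm_minus_commute)
      then have "weight p n * norm (w n) \<le> weight p n * norm (w (anc n) - w n) + weight p n * norm (w (anc n))"
        using mult_left_mono[OF _ weight_nonneg[of p n]] by (simp add: distrib_left[symmetric])
      then have "9 / 16 \<le> weight p n * norm (w (anc n))"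
        using big[OF n(1)] n(3) by linarith
      moreover have "2 * weight p n * norm (w (anc n)) \<le> weight p (anc n) * norm (w (anc n))"
        using wt by (intro mult_right_mono) auto
      ultimately have "9 / 8 \<le> norm (weight p (anc n) *\<^sub>R w (anc n))" by simp
      also have "\<dots> \<le> norm (u (anc n) + weight p (anc n) *\<^sub>R w (anc n)) + norm (u (anc n))"
        using norm_triangle_sub[of "weight p (anc n) *\<^sub>R w (anc n)" "- u (anc n)"] by (simp add: add.commute)
      finally show ?thesis using le1[of "anc n"] by linarith
    qed
    \<comment> \<open>Points sharing an ancestor m have the same \<open>val2\<close>, namely
      \<open>val2 m - i\<close>, and lie in the same cell, so at most 2^s of them exist. Hence
      counting ancestors suffices.\<close>
    have "card Gd = (\<Sum>m\<in>anc ` Gd. card {n \<in> Gd. anc n = m})"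
      using sum.image_gen[of Gd "\<lambda>_. 1::nat" anc] fin by simp
    also have "\<dots> \<le> (\<Sum>m\<in>anc ` Gd. 2 ^ s)"
    proof (rule sum_mono)
      fix m
      have "{n \<in> Gd. anc n = m} \<subseteq> {n \<in> Gd. val2 n = val2 m - i \<and> n div 2 ^ (val2 m - i + s) = m div 2 ^ (val2 m - i + s)}"
        using cell_ancestor(1,2) by (auto simp: anc_def s_def)
      then have "card {n \<in> Gd. anc n = m} \<le> card {n \<in> Gd. val2 n = val2 m - i \<and> n div 2 ^ (val2 m - i + s) = m div 2 ^ (val2 m - i + s)}"
        using fin by (intro card_mono) auto
      also have "\<dots> \<le> 2 ^ s" by (rule card_val2_cell_le)
      finally show "card {n \<in> Gd. anc n = m} \<le> 2 ^ s" .
    qed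
    finally have "card Gd \<le> 2 ^ s * card (anc ` Gd)" by (simp add: mult.commute)
    then have "real (card Gd) \<le> 2 ^ s * real (card (anc ` Gd))"
      using of_nat_mono[of "card Gd" "2 ^ s * card (anc ` Gd)", where 'a = real] by simp
    also have "\<dots> \<le> 2 ^ s * (\<alpha> / (1 / 8)) powr p"
      using 4 fin by (intro mult_left_mono card_le_weak_bound[OF p u]) auto
    finally have 5: "real (card Gd) \<le> 2 ^ s * 8 powr p * \<alpha> powr p"
      using nn by (simp add: powr_mult mult_ac)
    have "card A \<le> card (A1 \<union> T \<union> Os \<union> Gd)"
      using fin by (intro card_mono) (auto simp: Gd_def)
    also have "\<dots> \<le> card A1 + card T + card Os + card Gd"
      using card_Un_le[of "A1 \<union> T \<union> Os" Gd] card_Un_le[of "A1 \<union> T" Os] card_Un_le[of A1 T] by linarith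
    finally have "real (card A) \<le> real (card A1) + real (card T) + real (card Os) + real (card Gd)"
      by linarith
    also have "\<dots> \<le> (4 powr p + 2 ^ s * 8 powr p) * \<alpha> powr p + (16 / 3 * M1 + 4 / 3 * M2) * \<beta>"
      using 1 2 3 5 by (simp add: algebra_simps)
    also have "\<dots> \<le> C * \<alpha> powr p + C * \<beta>"
      using M1(1) M2(1) nn by (intro add_mono mult_right_mono) (auto simp: C_def)
    finally show "real (card A) \<le> C * (\<alpha> powr p + \<beta>)" by (simp add: distrib_left)
  qed
qed

text \<open>The set \<open>G\<close> where the perturbation is at least \<open>1 / 2\<close> is handled by its descendants: where the
  perturbation is huge, two descendants lie in \<open>G\<close> again, so at least half of \<open>G\<close> has moderate
  perturbation; there a deeper descendant has perturbation between \<open>\<tau>\<close> and \<open>1 / 2\<close>, which is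
  compatible with values in \<open>{0} \<union> {1..}\<close> only if \<open>u\<close> is not small.\<close>

lemma card_le_of_support:
  assumes p: "1 \<le> p"
  obtains C where "C \<ge> 0"
    "\<And>(u :: nat \<Rightarrow> 'k::real_normed_vector) w \<alpha> \<beta> A. weak_bound p u \<alpha> \<Longrightarrow> bv_bound w \<beta> \<Longrightarrow> finite A \<Longrightarrow>
      (\<And>n. n \<in> A \<Longrightarrow> 1 \<le> norm (u n + weight p n *\<^sub>R w n)) \<Longrightarrow>
      (\<And>n. n \<notin> A \<Longrightarrow> u n + weight p n *\<^sub>R w n = 0) \<Longrightarrow> real (card A) \<le> C * (\<alpha> powr p + \<beta>)"
proof -
  \<comment> \<open>Over k levels the weight then falls by a factor of at least 2^10, which takes
    256 * 3/2 down to 3/8 < 1/2.\<close>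
  define k where "k = nat \<lceil>80 * p\<rceil>"
  have k: "80 * p \<le> real k" unfolding k_def by linarith
  then have k2: "2 \<le> k" using p by linarith
  \<comment> \<open>This is 1/2 divided by 8 * 8^k, the smallest perturbation possible k levels
    below a non-oscillating point of \<open>G\<close>.\<close>
  define \<tau> :: real where "\<tau> = 1 / (16 * 8 ^ k)"
  have "(1::real) \<le> 8 ^ k" by (rule one_le_power) simp
  then have "(1::real) \<le> 8 * 8 ^ k" by linarith
  then have \<tau>: "0 < \<tau>" "\<tau> \<le> 1 / 2" by (auto simp: \<tau>_def field_simps)
  obtain M1 where M1: "M1 \<ge> 0"
    "\<And>(w :: nat \<Rightarrow> 'k) \<beta> S \<kappa> l. bv_bound w \<beta> \<Longrightarrow> finite S \<Longrightarrow>
      (\<And>n. n \<in> S \<Longrightarrow> l n div 2 ^ (val2 n + 0) = n div 2 ^ (val2 n + 0)) \<Longrightarrow>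
      (\<And>n. n \<in> S \<Longrightarrow> \<kappa> \<le> weight p n * norm (w (l n) - w n)) \<Longrightarrow>
      \<kappa> * real (card S) \<le> M1 * \<beta>"
    using card_oscillation_le[where 'k = 'k, OF p, of 0] by blast
  obtain M2 where M2: "M2 \<ge> 0"
    "\<And>(w :: nat \<Rightarrow> 'k) \<beta> S \<kappa>. bv_bound w \<beta> \<Longrightarrow> finite S \<Longrightarrow>
      (\<And>n. n \<in> S \<Longrightarrow> val2 n < k) \<Longrightarrow>
      (\<And>n. n \<in> S \<Longrightarrow> \<kappa> \<le> weight p n * norm (w n)) \<Longrightarrow>
      \<kappa> * real (card S) \<le> M2 * \<beta>"
    using card_bottom_le[where 'k = 'k, of k p] by blast
  define C where "C = 2 powr p + 2 * (1 / \<tau>) powr p + 8 * M1 + 4 * M2"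
  show thesis
  proof (rule that[of C])
    show "C \<ge> 0" using M1(1) M2(1) by (simp add: C_def)
    fix u w :: "nat \<Rightarrow> 'k" and \<alpha> \<beta> A
    assume u: "weak_bound p u \<alpha>" and w: "bv_bound w \<beta>" and A: "finite A"
      and ge1: "\<And>n. n \<in> A \<Longrightarrow> 1 \<le> norm (u n + weight p n *\<^sub>R w n)"
      and zero: "\<And>n. n \<notin> A \<Longrightarrow> u n + weight p n *\<^sub>R w n = 0"
    note nn = weak_bound_nonneg[OF u] bv_bound_nonneg[OF w]
    define H where "H n = weight p n * norm (w n)" for n
    define G where "G = {n. 1 / 2 \<le> H n}"
    define B0 where "B0 = {n \<in> G. val2 n < k}"
    define Os where "Os = {n \<in> G. \<exists>l. l div 2 ^ val2 n = n div 2 ^ val2 n \<and> 1 / 4 \<le> weight p n * norm (w l - w n)}"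
    \<comment> \<open>256 = (1/2) * 8 * 8^2: above it, descendants two levels down still have
      perturbation at least 1/2 and stay in \<open>G\<close>.\<close>
    define G1 where "G1 = {n \<in> G - B0 - Os. 256 \<le> H n}"
    define G2 where "G2 = {n \<in> G - B0 - Os. H n < 256}"
    \<comment> \<open>Finiteness allows \<open>card G1\<close> to be absorbed into
      \<open>card G\<close> below. It holds because \<open>H n\<close> is at most \<beta> times a
      weight tending to 0; \<beta> + 1 avoids dividing by zero.\<close>
    have finG: "finite G"
    proof (rule finite_subset)
      show "finite {n. 1 / (2 * (\<beta> + 1)) \<le> weight p n}"
        using nn by (intro finite_weight_ge[OF p]) auto
      show "G \<subseteq> {n. 1 / (2 * (\<beta> + 1)) \<le> weight p n}"
      proof safe
        fix n assume "n \<in> G"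
        then have "1 / 2 \<le> weight p n * norm (w n)" by (simp add: G_def H_def)
        also have "\<dots> \<le> weight p n * (\<beta> + 1)"
          using bv_boundD[OF w, of n] by (intro mult_left_mono) auto
        finally show "1 / (2 * (\<beta> + 1)) \<le> weight p n"
          using nn by (simp add: field_simps)
      qed
    qed
    then have fin: "finite B0" "finite Os" "finite G1" "finite G2"
      by (auto simp: B0_def Os_def G1_def G2_def)
    have 1: "1 / 2 * real (card B0) \<le> M2 * \<beta>"
      using M2(2)[OF w fin(1), of "1 / 2"] by (auto simp: B0_def G_def H_def)
    have 2: "1 / 4 * real (card Os) \<le> M1 * \<beta>"
    proof -
      have "\<forall>n\<in>Os. \<exists>l. l div 2 ^ val2 n = n div 2 ^ val2 n \<and> 1 / 4 \<le> weight p n * norm (w l - w n)"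
        by (simp add: Os_def)
      then obtain l where "\<forall>n\<in>Os. l n div 2 ^ val2 n = n div 2 ^ val2 n \<and> 1 / 4 \<le> weight p n * norm (w (l n) - w n)"
        by (auto dest: bchoice)
      then show ?thesis
        using M1(2)[OF w fin(2), of l "1 / 4"] by auto
    qed
    \<comment> \<open>Outside \<open>Os\<close> the oscillation within the cell contributes less
      than 1/4, which is at most \<open>H n / 2\<close>; so replacing \<open>w n\<close> by
      \<open>w l\<close> changes \<open>H n\<close> by a factor between 1/2 and 3/2. Outside
      \<open>B0\<close> there is room for k levels of descendants.\<close>
    have rest: "n > 0" "k \<le> val2 n" "1 / 2 \<le> H n"
      "l div 2 ^ val2 n = n div 2 ^ val2 n \<Longrightarrow> H n / 2 \<le> weight p n * norm (w l)"
      "l div 2 ^ val2 n = n div 2 ^ val2 n \<Longrightarrow> weight p n * norm (w l) \<le> 3 / 2 * H n"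
      if n: "n \<in> G - B0 - Os" for n l
    proof -
      show half: "1 / 2 \<le> H n" "k \<le> val2 n" using n by (auto simp: G_def B0_def)
      then show "n > 0" by (intro gr0I) (simp add: H_def)
      assume "l div 2 ^ val2 n = n div 2 ^ val2 n"
      then have osc: "weight p n * norm (w l - w n) < 1 / 4"
        using n by (auto simp: Os_def not_le)
      have "norm (w n) \<le> norm (w l - w n) + norm (w l)" "norm (w l) \<le> norm (w l - w n) + norm (w n)"
        using norm_triangle_sub[of "w n" "w l"] norm_triangle_sub[of "w l" "w n"]
        by (simp_all add: norm_minus_commute add.commute)
      then have "weight p n * norm (w n) \<le> weight p n * norm (w l - w n) + weight p n * norm (w l)"
        "weight p n * norm (w l) \<le> weight p n * norm (w l - w n) + weight p n * norm (w n)"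
        using mult_left_mono[OF _ weight_nonneg[of p n]] by (simp_all add: distrib_left[symmetric])
      then show "H n / 2 \<le> weight p n * norm (w l)" "weight p n * norm (w l) \<le> 3 / 2 * H n"
        using half osc by (auto simp: H_def)
    qed
    have desc: "val2 (n + r * 2 ^ (val2 n - j)) + j = val2 n" 
      "(n + r * 2 ^ (val2 n - j)) div 2 ^ val2 n = n div 2 ^ val2 n"
      "H n / (8 * 8 ^ j) \<le> H (n + r * 2 ^ (val2 n - j))"
      "H (n + r * 2 ^ (val2 n - j)) \<le> 2 powr (- real j / (8 * p)) * (3 / 2 * H n)"
      if n: "n \<in> G - B0 - Os" and j: "0 < j" "j \<le> k" and r: "odd r" "r < 2 ^ j" for n r j
    proof -
      let ?m = "n + r * 2 ^ (val2 n - j)"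
      have jv: "j \<le> val2 n" using rest(2)[OF n] j by simp
      note d = cell_descendant[OF rest(1)[OF n] jv r j(1)]
      show "val2 ?m + j = val2 n" "?m div 2 ^ val2 n = n div 2 ^ val2 n" using d by auto
      have m0: "?m > 0" using rest(1)[OF n] by simp
      have "H n / (8 * 8 ^ j) = H n / 2 / (4 * 8 ^ j)" by simp
      also have "\<dots> \<le> weight p n * norm (w ?m) / (4 * 8 ^ j)"
        by (intro divide_right_mono rest(4)[OF n] d) auto
      also have "\<dots> = weight p n / (4 * 8 ^ j) * norm (w ?m)" by simp
      also have "\<dots> \<le> H ?m"
        unfolding H_def using weight_descendant_ge[OF p m0 d(1)[symmetric] d(3)] by (intro mult_right_mono) auto
      finally show "H n / (8 * 8 ^ j) \<le> H ?m" .
      have "H ?m \<le> 2 powr (- real j / (8 * p)) * weight p n * norm (w ?m)"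
        unfolding H_def using weight_descendant_le[OF p rest(1)[OF n] d(1)[symmetric]] by (intro mult_right_mono) auto
      also have "\<dots> = 2 powr (- real j / (8 * p)) * (weight p n * norm (w ?m))" by simp
      also have "\<dots> \<le> 2 powr (- real j / (8 * p)) * (3 / 2 * H n)"
        by (intro mult_left_mono rest(5)[OF n] d) auto
      finally show "H ?m \<le> 2 powr (- real j / (8 * p)) * (3 / 2 * H n)" .
    qed
    \<comment> \<open>The descendant determines \<open>val2 n\<close> by adding j, and then its
      quotient by 2^(val2 n) determines n, which is a multiple of that power.\<close>
    have inj: "n = n'"
      if "n \<in> G - B0 - Os" "n' \<in> G - B0 - Os" "0 < j" "j \<le> k" "odd r" "r < 2 ^ j" "odd r'" "r' < 2 ^ j"
        "n + r * 2 ^ (val2 n - j) = n' + r' * 2 ^ (val2 n' - j)" for n n' r r' j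
    proof -
      have v: "val2 n = val2 n'"
        using desc(1)[OF that(1,3,4,5,6)] desc(1)[OF that(2,3,4,7,8)] that(9) by simp
      have "n div 2 ^ val2 n = n' div 2 ^ val2 n'"
        using desc(2)[OF that(1,3,4,5,6)] desc(2)[OF that(2,3,4,7,8)] that(9) v by simp
      then show ?thesis
        using v by (metis dvd_div_mult_self multiplicity_dvd)
    qed
    \<comment> \<open>The offsets r = 1 and r = 3, two levels down, give two injections of
      \<open>G1\<close> into \<open>G\<close> with disjoint images.\<close>
    have 3: "2 * card G1 \<le> card G"
    proof -
      let ?c = "\<lambda>r n. n + r * 2 ^ (val2 n - 2)"
      have sub: "G1 \<subseteq> G - B0 - Os" by (auto simp: G1_def)
      have i: "inj_on (?c r) G1" if "odd r" "r < 2 ^ 2" for r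
        using inj[of _ _ 2 r r] that k2 sub by (intro inj_onI) auto
      have "?c 1 ` G1 \<inter> ?c 3 ` G1 = {}"
      proof (rule ccontr)
        assume "?c 1 ` G1 \<inter> ?c 3 ` G1 \<noteq> {}"
        then obtain n n' where nn': "n \<in> G1" "n' \<in> G1" "?c 1 n = ?c 3 n'" by blast
        then have "n = n'" using inj[of n n' 2 1 3] sub k2 by auto
        with nn'(3) show False by simp
      qed
      then have "card (?c 1 ` G1 \<union> ?c 3 ` G1) = card (?c 1 ` G1) + card (?c 3 ` G1)"
        using fin by (intro card_Un_disjoint) auto
      also have "\<dots> = 2 * card G1"
        using i[of 1] i[of 3] by (simp add: card_image)
      finally have "2 * card G1 = card (?c 1 ` G1 \<union> ?c 3 ` G1)" by simp
      also have "\<dots> \<le> card G"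
      proof (intro card_mono finG Un_least; rule image_subsetI)
        have "?c r n \<in> G" if "odd r" "r < 2 ^ 2" "n \<in> G1" for r n
          using desc(3)[of n 2 r] that k2 by (auto simp: G_def G1_def)
        from this[of 1] this[of 3] show "?c 1 n \<in> G" "?c 3 n \<in> G" if "n \<in> G1" for n
          using that by auto
      qed
      finally show ?thesis .
    qed
    have 4: "real (card G2) \<le> (\<alpha> / \<tau>) powr p"
    proof -
      let ?d = "\<lambda>n. n + 1 * 2 ^ (val2 n - k)"
      have sub: "G2 \<subseteq> G - B0 - Os" by (auto simp: G2_def)
      have "inj_on ?d G2"
        using inj[of _ _ k 1 1] k2 sub one_less_power[of "2::nat" k] by (intro inj_onI) auto
      then have "card G2 = card (?d ` G2)" by (simp add: card_image)
      moreover have "\<tau> \<le> norm (u m)" if m: "m \<in> ?d ` G2" for m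
      proof -
        obtain n where n: "n \<in> G2" "m = ?d n" using m by blast
        have n': "n \<in> G - B0 - Os" "H n < 256" "1 / 2 \<le> H n" using n by (auto simp: G2_def G_def)
        have r: "odd (1::nat)" "(1::nat) < 2 ^ k" using k2 one_less_power[of "2::nat" k] by auto
        have "2 powr (- real k / (8 * p)) \<le> 2 powr (- 10)"
          using k p by (intro powr_mono) (auto simp: field_simps)
        also have "\<dots> = (1 / 1024 :: real)"
          by (simp add: powr_minus powr_numeral)
        finally have e: "2 powr (- real k / (8 * p)) \<le> 1 / 1024" .
        have "H m \<le> 2 powr (- real k / (8 * p)) * (3 / 2 * H n)"
          unfolding n(2) using desc(4)[OF n'(1) _ _ r] k2 by simp
        also have "\<dots> \<le> 1 / 1024 * (3 / 2 * 256)"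
          using e n' by (intro mult_mono) auto
        finally have up: "H m \<le> 1 / 2" by simp
        have "\<tau> = 1 / 2 / (8 * 8 ^ k)" by (simp add: \<tau>_def)
        also have "\<dots> \<le> H n / (8 * 8 ^ k)" using n'(3) by (intro divide_right_mono) auto
        also have "\<dots> \<le> H m"
          unfolding n(2) using desc(3)[OF n'(1) _ _ r] k2 by simp
        finally have lo: "\<tau> \<le> H m" .
        have nm: "norm (weight p m *\<^sub>R w m) = H m" by (simp add: H_def)
        show "\<tau> \<le> norm (u m)"
        \<comment> \<open>The sequence has modulus at least 1 on A and is 0 elsewhere, whereas
          \<open>H m\<close> lies between \<tau> and 1/2. So u contributes at least 1/2 on A, and
          exactly \<open>H m\<close> in modulus off A.\<close>
        proof (cases "m \<in> A")
          case True
          then have "1 \<le> norm (u m) + H m"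
            using ge1[of m] norm_triangle_ineq[of "u m" "weight p m *\<^sub>R w m"] nm by linarith
          then show ?thesis using up \<tau> by linarith
        next
          case False
          then have "u m = - (weight p m *\<^sub>R w m)"
            using zero by (simp add: eq_neg_iff_add_eq_0)
          then show ?thesis using lo nm by (metis norm_minus_cancel)
        qed
      qed
      ultimately show ?thesis
        using card_le_weak_bound[OF p u, of "?d ` G2" \<tau>] fin \<tau> by auto
    qed
    have "card G \<le> card (G1 \<union> G2 \<union> B0 \<union> Os)"
      using fin by (intro card_mono) (auto simp: G1_def G2_def)
    also have "\<dots> \<le> card G1 + card G2 + card B0 + card Os"
      using card_Un_le[of "G1 \<union> G2 \<union> B0" Os] card_Un_le[of "G1 \<union> G2" B0] card_Un_le[of G1 G2] by linarith
    finally have "card G \<le> card G1 + card G2 + card B0 + card Os" .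
    \<comment> \<open>At most half of \<open>G\<close> lies in \<open>G1\<close>, so the other three
      sets carry at least the other half.\<close>
    then have 5: "card G \<le> 2 * (card G2 + card B0 + card Os)"
      using 3 by (simp add: distrib_left)
    define A1 where "A1 = {n \<in> A. 1 / 2 \<le> norm (u n)}"
    have "A \<subseteq> A1 \<union> G"
    proof
      fix n assume "n \<in> A"
      then have "1 \<le> norm (u n) + norm (weight p n *\<^sub>R w n)"
        using ge1 norm_triangle_ineq order_trans by blast
      then show "n \<in> A1 \<union> G"
        using \<open>n \<in> A\<close> by (auto simp: A1_def G_def H_def)
    qed
    then have "card A \<le> card (A1 \<union> G)"
      using A finG by (intro card_mono) (auto simp: A1_def)
    also have "\<dots> \<le> card A1 + card G" by (rule card_Un_le)
    finally have "card A \<le> card A1 + card G" .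
    then have "card A \<le> card A1 + 2 * (card G2 + card B0 + card Os)"
      using 5 by simp
    then have "real (card A) \<le> real (card A1 + 2 * (card G2 + card B0 + card Os))"
      by (rule of_nat_mono)
    then have "real (card A) \<le> real (card A1) + 2 * (real (card G2) + real (card B0) + real (card Os))"
      by simp
    also have "real (card A1) \<le> 2 powr p * \<alpha> powr p"
      using card_le_weak_bound[OF p u, of A1 "1 / 2"] A nn
      by (simp add: A1_def powr_mult mult.commute)
    finally have "real (card A) \<le> 2 powr p * \<alpha> powr p + 2 * (\<alpha> / \<tau>) powr p + (8 * M1 + 4 * M2) * \<beta>"
      using 1 2 4 by (simp add: algebra_simps)
    also have "(\<alpha> / \<tau>) powr p = (1 / \<tau>) powr p * \<alpha> powr p"
      using nn \<tau> by (simp add: powr_mult[symmetric])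
    also have "2 powr p * \<alpha> powr p + 2 * ((1 / \<tau>) powr p * \<alpha> powr p) + (8 * M1 + 4 * M2) * \<beta>
        = (2 powr p + 2 * (1 / \<tau>) powr p) * \<alpha> powr p + (8 * M1 + 4 * M2) * \<beta>"
      by (simp add: algebra_simps)
    also have "\<dots> \<le> C * \<alpha> powr p + C * \<beta>"
      using M1(1) M2(1) nn by (intro add_mono mult_right_mono) (auto simp: C_def)
    finally show "real (card A) \<le> C * (\<alpha> powr p + \<beta>)" by (simp add: distrib_left)
  qed
qed

section \<open>The quotient space\<close>

text \<open>A decomposition of cost at most r. Keeping the cost as a parameter lets estimates be
  proved for single decompositions before passing to the infimum, which need not be
  attained.\<close>

definition represents :: "real \<Rightarrow> (nat \<Rightarrow> 'k::real_normed_vector) \<Rightarrow> real \<Rightarrow> bool" where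
  "represents p h r \<longleftrightarrow> (\<exists>u w \<alpha> \<beta>. weak_bound p u \<alpha> \<and> bv_bound w \<beta> \<and> \<alpha> + \<beta> \<le> r \<and>
    (\<forall>n. h n = u n + weight p n *\<^sub>R w n))"

definition trunc :: "nat \<Rightarrow> (nat \<Rightarrow> 'k::zero) \<Rightarrow> nat \<Rightarrow> 'k" where
  "trunc m h = (\<lambda>n. if n < m then h n else 0)"

text \<open>Weights are at most 1, so coordinates are controlled by \<alpha> + \<beta>. The
  coordinate functionals are therefore contractions.\<close>

lemma norm_le_represents:
  assumes "1 \<le> p" "represents p h r"
  shows "norm (h n) \<le> r"
proof -
  obtain u w \<alpha> \<beta> where h: "weak_bound p u \<alpha>" "bv_bound w \<beta>" "\<alpha> + \<beta> \<le> r" "h n = u n + weight p n *\<^sub>R w n"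
    using assms unfolding represents_def by blast
  have "norm (h n) \<le> norm (u n) + weight p n * norm (w n)"
    unfolding h(4) using norm_triangle_ineq[of "u n" "weight p n *\<^sub>R w n"] by simp
  also have "\<dots> \<le> \<alpha> + 1 * \<beta>"
    using weak_boundD[OF h(1)] bv_boundD[OF h(2)] weight_le_1[OF assms(1)]
    by (intro add_mono mult_mono) auto
  finally show ?thesis using h(3) by simp
qed

lemma represents_nonneg: "1 \<le> p \<Longrightarrow> represents p h r \<Longrightarrow> 0 \<le> r"
  using norm_le_represents[of p h r 0] norm_ge_zero order_trans by blast

lemma represents_mono: "represents p h r \<Longrightarrow> r \<le> s \<Longrightarrow> represents p h s"
  unfolding represents_def by (meson order_trans)

lemma weak_bound_scale:
  fixes c :: "'k::real_normed_field"
  shows "weak_bound p u \<alpha> \<Longrightarrow> weak_bound p (\<lambda>n. c * u n) (norm c * \<alpha>)"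
  unfolding weak_bound_def
  by (simp add: norm_mult sum_distrib_left[symmetric] mult.assoc mult_left_mono)

lemma bv_bound_scale:
  fixes c :: "'k::real_normed_field"
  assumes "bv_bound w \<beta>"
  shows "bv_bound (\<lambda>n. c * w n) (norm c * \<beta>)"
  unfolding bv_bound_def
proof
  fix N
  have "norm c * (norm (w N) + (\<Sum>k<N. norm (w k - w (Suc k)))) \<le> norm c * \<beta>"
    using assms by (intro mult_left_mono) (auto simp: bv_bound_def)
  then show "norm (c * w N) + (\<Sum>k<N. norm (c * w k - c * w (Suc k))) \<le> norm c * \<beta>"
    by (simp add: right_diff_distrib[symmetric] norm_mult sum_distrib_left distrib_left)
qed

lemma represents_scale:
  fixes c :: "'k::real_normed_field"
  assumes "represents p h r"
  shows "represents p (\<lambda>n. c * h n) (norm c * r)"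
proof -
  obtain u w \<alpha> \<beta> where h: "weak_bound p u \<alpha>" "bv_bound w \<beta>" "\<alpha> + \<beta> \<le> r" "\<And>n. h n = u n + weight p n *\<^sub>R w n"
    using assms unfolding represents_def by blast
  have "norm c * \<alpha> + norm c * \<beta> \<le> norm c * r"
    using mult_left_mono[OF h(3), of "norm c"] by (simp add: distrib_left)
  then show ?thesis
    unfolding represents_def
    using weak_bound_scale[OF h(1), of c] bv_bound_scale[OF h(2), of c] h(4)
    by (intro exI[of _ "\<lambda>n. c * u n"] exI[of _ "\<lambda>n. c * w n"] exI[of _ "norm c * \<alpha>"] exI[of _ "norm c * \<beta>"])
      (simp add: distrib_left)
qed

text \<open>Decompositions are chosen term by term and summed; both bounds are countably
  subadditive. This yields the triangle inequality as the two-term case and completeness through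
  absolutely convergent series.\<close>

lemma represents_suminf:
  fixes h :: "nat \<Rightarrow> nat \<Rightarrow> 'k::banach"
  assumes p: "1 \<le> p" and h: "\<And>m. represents p (h m) (r m)" and r: "summable r"
  shows "represents p (\<lambda>n. \<Sum>m. h m n) (\<Sum>m. r m)"
proof -
  have "\<forall>m. \<exists>u w \<alpha> \<beta>. weak_bound p u \<alpha> \<and> bv_bound w \<beta> \<and> \<alpha> + \<beta> \<le> r m \<and>
    (\<forall>n. h m n = u n + weight p n *\<^sub>R w n)"
    using h unfolding represents_def by blast
  then obtain u w \<alpha> \<beta> where H: "\<And>m. weak_bound p (u m) (\<alpha> m)" "\<And>m. bv_bound (w m) (\<beta> m)"
    "\<And>m. \<alpha> m + \<beta> m \<le> r m" "\<And>m n. h m n = u m n + weight p n *\<^sub>R w m n"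
    by metis
  have nn: "0 \<le> \<alpha> m" "0 \<le> \<beta> m" for m
    using weak_bound_nonneg[OF H(1)] bv_bound_nonneg[OF H(2)] by auto
  have sm\<alpha>: "summable \<alpha>" and sm\<beta>: "summable \<beta>"
    using H(3) nn by (auto intro!: summable_comparison_test'[OF r, of 0])
      (smt (verit, best) H(3) nn)+
  have smu': "summable (\<lambda>m. norm (u m n))" for n
    using weak_boundD[OF H(1)] by (intro summable_comparison_test'[OF sm\<alpha>, of 0]) auto
  have smw': "summable (\<lambda>m. norm (w m n))" for n
    using bv_boundD[OF H(2)] by (intro summable_comparison_test'[OF sm\<beta>, of 0]) auto
  note smu = summable_norm_cancel[OF smu'] and smw = summable_norm_cancel[OF smw']
  have smd': "summable (\<lambda>m. norm (w m k - w m (Suc k)))" for k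
    by (rule summable_comparison_test'[OF summable_add[OF smw'[of k] smw'[of "Suc k"]], of 0])
      (simp add: norm_triangle_ineq4)
  have "weak_bound p (\<lambda>n. \<Sum>m. u m n) (\<Sum>m. \<alpha> m)"
    unfolding weak_bound_def
  proof (intro allI impI)
    fix B :: "nat set" assume B: "finite B"
    have "(\<Sum>n\<in>B. norm (\<Sum>m. u m n)) \<le> (\<Sum>n\<in>B. \<Sum>m. norm (u m n))"
      by (intro sum_mono summable_norm smu')
    also have "\<dots> = (\<Sum>m. \<Sum>n\<in>B. norm (u m n))"
      by (rule suminf_sum[symmetric]) (rule smu')
    also have "\<dots> \<le> (\<Sum>m. \<alpha> m * real (card B) powr (1 - 1 / p))"
      using H(1) B by (intro suminf_le summable_sum smu' summable_mult2 sm\<alpha>) (auto simp: weak_bound_def)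
    also have "\<dots> = (\<Sum>m. \<alpha> m) * real (card B) powr (1 - 1 / p)"
      by (rule suminf_mult2[OF sm\<alpha>, symmetric])
    finally show "(\<Sum>n\<in>B. norm (\<Sum>m. u m n)) \<le> (\<Sum>m. \<alpha> m) * real (card B) powr (1 - 1 / p)" .
  qed
  moreover have "bv_bound (\<lambda>n. \<Sum>m. w m n) (\<Sum>m. \<beta> m)"
    unfolding bv_bound_def
  proof
    fix N
    have "norm (\<Sum>m. w m N) + (\<Sum>k<N. norm ((\<Sum>m. w m k) - (\<Sum>m. w m (Suc k))))
        = norm (\<Sum>m. w m N) + (\<Sum>k<N. norm (\<Sum>m. w m k - w m (Suc k)))"
      by (simp add: suminf_diff[OF smw smw])
    also have "\<dots> \<le> (\<Sum>m. norm (w m N)) + (\<Sum>k<N. \<Sum>m. norm (w m k - w m (Suc k)))"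
      by (intro add_mono sum_mono summable_norm smw' smd')
    also have "\<dots> = (\<Sum>m. norm (w m N)) + (\<Sum>m. \<Sum>k<N. norm (w m k - w m (Suc k)))"
      by (subst suminf_sum[symmetric]) (rule smd', simp)
    also have "\<dots> = (\<Sum>m. norm (w m N) + (\<Sum>k<N. norm (w m k - w m (Suc k))))"
      by (intro suminf_add smw' summable_sum smd')
    also have "\<dots> \<le> (\<Sum>m. \<beta> m)"
      using H(2) by (intro suminf_le summable_add summable_sum smw' smd' sm\<beta>) (auto simp: bv_bound_def)
    finally show "norm (\<Sum>m. w m N) + (\<Sum>k<N. norm ((\<Sum>m. w m k) - (\<Sum>m. w m (Suc k)))) \<le> (\<Sum>m. \<beta> m)" .
  qed
  moreover have "(\<Sum>m. \<alpha> m) + (\<Sum>m. \<beta> m) \<le> (\<Sum>m. r m)"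
    using H(3) by (subst suminf_add[OF sm\<alpha> sm\<beta>]) (intro suminf_le summable_add sm\<alpha> sm\<beta> r)
  moreover have "(\<Sum>m. h m n) = (\<Sum>m. u m n) + weight p n *\<^sub>R (\<Sum>m. w m n)" for n
    unfolding H(4)
    by (simp add: suminf_add[symmetric] suminf_scaleR_right smu smw summable_scaleR_right)
  ultimately show ?thesis unfolding represents_def by blast
qed

lemma represents_0: "represents p (\<lambda>n. 0) 0"
proof -
  have "weak_bound p (\<lambda>n. 0) 0" "bv_bound (\<lambda>n. 0) 0"
    by (simp_all add: weak_bound_def bv_bound_def)
  then show ?thesis unfolding represents_def by force
qed

lemma represents_add:
  fixes h g :: "nat \<Rightarrow> 'k::banach"
  assumes p: "1 \<le> p" and "represents p h r" "represents p g s"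
  shows "represents p (\<lambda>n. h n + g n) (r + s)"
proof -
  define f where "f m = (if m = 0 then h else if m = 1 then g else (\<lambda>n. 0))" for m :: nat
  define t where "t m = (if m = 0 then r else if m = 1 then s else 0)" for m :: nat
  have t: "t sums (\<Sum>m\<in>{0, 1}. t m)" by (rule sums_finite) (auto simp: t_def)
  have f: "(\<lambda>m. f m n) sums (\<Sum>m\<in>{0, 1}. f m n)" for n by (rule sums_finite) (auto simp: f_def)
  have "represents p (\<lambda>n. \<Sum>m. f m n) (\<Sum>m. t m)"
    by (rule represents_suminf[OF p _ sums_summable[OF t]])
      (use assms represents_0 in \<open>auto simp: f_def t_def\<close>)
  moreover have "(\<Sum>m\<in>{0, 1}. t m) = r + s" "(\<Sum>m\<in>{0, 1}. f m n) = h n + g n" for n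
    by (simp_all add: t_def f_def)
  ultimately show ?thesis
    using sums_unique[OF t] sums_unique[OF f] by simp
qed

text \<open>Cutting w after j creates one new jump, of size \<open>norm (w j)\<close>. The resulting
  variation is precisely the quantity that \<open>bv_bound\<close> controls at N = j.\<close>

lemma bv_bound_trunc:
  fixes w :: "nat \<Rightarrow> 'k::real_normed_vector"
  assumes "bv_bound w \<beta>"
  shows "bv_bound (trunc m w) \<beta>"
  unfolding bv_bound_def
proof
  fix N
  have inner: "(\<Sum>k<M. norm (trunc m w k - trunc m w (Suc k))) = (\<Sum>k<M. norm (w k - w (Suc k)))" if "M < m" for M
    using that by (intro sum.cong) (auto simp: trunc_def)
  show "norm (trunc m w N) + (\<Sum>k<N. norm (trunc m w k - trunc m w (Suc k))) \<le> \<beta>"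
  proof (cases "N < m")
    case True
    then show ?thesis using assms inner[of N] by (simp add: trunc_def bv_bound_def)
  next
    case False
    show ?thesis
    proof (cases m)
      case 0
      then show ?thesis using bv_bound_nonneg[OF assms] by (simp add: trunc_def)
    next
      case (Suc j)
      have "(\<Sum>k<N. norm (trunc m w k - trunc m w (Suc k))) = (\<Sum>k<Suc j. norm (trunc m w k - trunc m w (Suc k)))"
        using False Suc by (intro sum.mono_neutral_right) (auto simp: trunc_def)
      also have "\<dots> = (\<Sum>k<j. norm (w k - w (Suc k))) + norm (w j)"
        using inner[of j] Suc by (simp add: trunc_def)
      finally show ?thesis
        using assms False Suc by (simp add: trunc_def bv_bound_def add.commute)
    qed
  qed
qed

lemma weak_bound_trunc:
  fixes u :: "nat \<Rightarrow> 'k::real_normed_vector"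
  assumes "weak_bound p u \<alpha>"
  shows "weak_bound p (trunc m u) \<alpha>"
  unfolding weak_bound_def
proof (intro allI impI)
  fix B :: "nat set" assume B: "finite B"
  have "(\<Sum>n\<in>B. norm (trunc m u n)) \<le> (\<Sum>n\<in>B. norm (u n))"
    by (intro sum_mono) (simp add: trunc_def)
  also have "\<dots> \<le> \<alpha> * real (card B) powr (1 - 1 / p)"
    using assms B by (simp add: weak_bound_def)
  finally show "(\<Sum>n\<in>B. norm (trunc m u n)) \<le> \<alpha> * real (card B) powr (1 - 1 / p)" .
qed

text \<open>Truncation acts on u and w separately, so the partial sum projections are
  contractions.\<close>

lemma represents_trunc:
  assumes "represents p h r"
  shows "represents p (trunc m h) r"
proof -
  obtain u w \<alpha> \<beta> where h: "weak_bound p u \<alpha>" "bv_bound w \<beta>" "\<alpha> + \<beta> \<le> r" "\<And>n. h n = u n + weight p n *\<^sub>R w n"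
    using assms unfolding represents_def by blast
  have "trunc m h n = trunc m u n + weight p n *\<^sub>R trunc m w n" for n
    using h(4) by (simp add: trunc_def)
  then show ?thesis
    unfolding represents_def using weak_bound_trunc[OF h(1)] bv_bound_trunc[OF h(2)] h(3) by blast
qed

text \<open>Take w = 0. With c = |A \<inter> B|, split c = c^(1/p) c^(1-1/p) and bound the first
  factor through A, the second through B.\<close>

lemma represents_finite_support:
  fixes b :: "nat \<Rightarrow> 'k::real_normed_vector"
  assumes p: "1 \<le> p" and A: "finite A" "\<And>n. n \<notin> A \<Longrightarrow> b n = 0" and M: "\<And>n. n \<in> A \<Longrightarrow> norm (b n) \<le> M" "0 \<le> M"
  shows "represents p b (M * real (card A) powr (1 / p))"
proof -
  have "weak_bound p b (M * real (card A) powr (1 / p))"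
    unfolding weak_bound_def
  proof (intro allI impI)
    fix B :: "nat set" assume B: "finite B"
    define c where "c = real (card (A \<inter> B))"
    have c: "c \<le> real (card A)" "c \<le> real (card B)" "0 \<le> c"
      using A B by (auto simp: c_def intro!: card_mono)
    have "(\<Sum>n\<in>B. norm (b n)) = (\<Sum>n\<in>A \<inter> B. norm (b n))"
      using B A by (intro sum.mono_neutral_right) auto
    also have "\<dots> \<le> (\<Sum>n\<in>A \<inter> B. M)" using M by (intro sum_mono) auto
    also have "\<dots> = M * c" by (simp add: c_def)
    also have "\<dots> = M * (c powr (1 / p) * c powr (1 - 1 / p))"
      using c(3) by (cases "c = 0") (auto simp: powr_add[symmetric])
    also have "\<dots> \<le> M * (real (card A) powr (1 / p) * real (card B) powr (1 - 1 / p))"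
      using c p M by (intro mult_left_mono mult_mono powr_mono2) auto
    finally show "(\<Sum>n\<in>B. norm (b n)) \<le> M * real (card A) powr (1 / p) * real (card B) powr (1 - 1 / p)"
      by (simp add: mult.assoc)
  qed
  moreover have "bv_bound (\<lambda>n. 0 :: 'k) 0" by (simp add: bv_bound_def)
  ultimately show ?thesis
    unfolding represents_def
    by (intro exI[of _ b] exI[of _ "\<lambda>n. 0"] exI[of _ "M * real (card A) powr (1 / p)"] exI[of _ 0]) auto
qed

text \<open>The decomposition u = 0, w = 1 of the full weight costs 1. These truncations are the
  test vectors against truncation quasi-greediness.\<close>

lemma represents_trunc_weight: "represents p (trunc m (\<lambda>n. of_real (weight p n) :: 'k::real_normed_algebra_1)) 1"
proof (rule represents_trunc)
  have "bv_bound (\<lambda>n. 1 :: 'k) 1" "weak_bound p (\<lambda>n. 0 :: 'k) 0"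
    by (simp_all add: bv_bound_def weak_bound_def)
  then show "represents p (\<lambda>n. of_real (weight p n) :: 'k) 1"
    unfolding represents_def
    by (intro exI[of _ "\<lambda>n. 0"] exI[of _ "\<lambda>n. 1"] exI[of _ 0] exI[of _ 1]) (auto simp: of_real_def)
qed

section \<open>The quotient norm\<close>

definition qnorm :: "real \<Rightarrow> (nat \<Rightarrow> 'k::real_normed_vector) \<Rightarrow> real" where
  "qnorm p h = Inf {r. represents p h r}"

definition representable :: "real \<Rightarrow> (nat \<Rightarrow> 'k::real_normed_vector) \<Rightarrow> bool" where
  "representable p h \<longleftrightarrow> (\<exists>r. represents p h r)"

text \<open>The closure of the finitely supported sequences. Because truncations are contractions,
  membership amounts to convergence of the sequence's own truncations, which is the basis
  expansion.\<close>

definition qspace :: "real \<Rightarrow> (nat \<Rightarrow> 'k::real_normed_vector) set" where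
  "qspace p = {h. representable p h \<and> (\<lambda>m. qnorm p (\<lambda>n. h n - trunc m h n)) \<longlonglongrightarrow> 0}"

context
  fixes p :: real
  assumes p: "1 \<le> p"
begin

lemma qnorm_le: "represents p h r \<Longrightarrow> qnorm p h \<le> r"
  unfolding qnorm_def by (rule cInf_lower) (auto intro!: bdd_belowI[of _ 0] represents_nonneg[OF p])

lemma qnorm_less_represents:
  assumes "representable p h" "qnorm p h < r"
  shows "represents p h r"
proof -
  obtain s where "represents p h s" "s < r"
    using cInf_lessD[of "{r. represents p h r}" r] assms by (auto simp: qnorm_def representable_def)
  then show ?thesis by (meson less_imp_le represents_mono)
qed

lemma le_qnormI:
  assumes "representable p h" "\<And>r. represents p h r \<Longrightarrow> c \<le> r"
  shows "c \<le> qnorm p h"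
  unfolding qnorm_def using assms by (intro cInf_greatest) (auto simp: representable_def)

lemma norm_le_qnorm: "representable p h \<Longrightarrow> norm (h n) \<le> qnorm p h"
  by (rule le_qnormI) (auto intro: norm_le_represents[OF p])

lemma qnorm_nonneg: "representable p h \<Longrightarrow> 0 \<le> qnorm p h"
  using norm_le_qnorm[of h 0] norm_ge_zero order_trans by blast

lemma representable_finite: 
  assumes "finite A" "\<And>n. n \<notin> A \<Longrightarrow> b n = 0"
  shows "representable p b"
proof -
  obtain M where "\<And>n. n \<in> A \<Longrightarrow> norm (b n) \<le> M" "0 \<le> M"
  proof
    fix n assume "n \<in> A"
    then show "norm (b n) \<le> (\<Sum>n\<in>A. norm (b n))"
      using assms by (intro member_le_sum) auto
  qed (simp add: sum_nonneg)
  then show ?thesis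
    using represents_finite_support[where b = b and M = M, OF p assms(1)] assms(2)
    by (auto simp: representable_def)
qed

lemma qnorm_0: "qnorm p (\<lambda>n. 0) = 0"
  using qnorm_le[OF represents_0] qnorm_nonneg[of "\<lambda>n. 0"] represents_0
  by (auto simp: representable_def intro: antisym)

lemma representable_add:
  fixes h g :: "nat \<Rightarrow> 'k::banach"
  shows "representable p h \<Longrightarrow> representable p g \<Longrightarrow> representable p (\<lambda>n. h n + g n)"
  unfolding representable_def using represents_add[OF p] by blast

lemma qnorm_add_le:
  fixes h g :: "nat \<Rightarrow> 'k::banach"
  assumes "representable p h" "representable p g"
  shows "qnorm p (\<lambda>n. h n + g n) \<le> qnorm p h + qnorm p g"
proof (rule field_le_epsilon)
  fix e :: real assume "e > 0"
  then have "represents p h (qnorm p h + e / 2)" "represents p g (qnorm p g + e / 2)"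
    using assms by (auto intro!: qnorm_less_represents)
  from qnorm_le[OF represents_add[OF p this]]
  show "qnorm p (\<lambda>n. h n + g n) \<le> qnorm p h + qnorm p g + e" by simp
qed

lemma representable_scale:
  fixes c :: "'k::real_normed_field"
  shows "representable p h \<Longrightarrow> representable p (\<lambda>n. c * h n)"
  unfolding representable_def using represents_scale by blast

lemma qnorm_scale:
  fixes c :: "'k::real_normed_field"
  assumes "representable p h"
  shows "qnorm p (\<lambda>n. c * h n) = norm c * qnorm p h"
proof -
  have le: "qnorm p (\<lambda>n. a * g n) \<le> norm a * qnorm p g" if "representable p g" for a :: 'k and g
  proof (cases "a = 0")
    case False
    show ?thesis
    proof (rule field_le_epsilon)
      fix e :: real assume "e > 0"
      then have "represents p g (qnorm p g + e / norm a)"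
        using False that by (auto intro!: qnorm_less_represents)
      from qnorm_le[OF represents_scale[OF this, of a]]
      show "qnorm p (\<lambda>n. a * g n) \<le> norm a * qnorm p g + e" using False by (simp add: distrib_left)
    qed
  qed (simp add: qnorm_0)
  show ?thesis
  proof (cases "c = 0")
    case False
    have "qnorm p h = qnorm p (\<lambda>n. inverse c * (c * h n))"
      using False by (simp add: mult.assoc[symmetric])
    also have "\<dots> \<le> norm (inverse c) * qnorm p (\<lambda>n. c * h n)"
      by (rule le) (rule representable_scale[OF assms])
    finally have "norm c * qnorm p h \<le> norm c * (norm (inverse c) * qnorm p (\<lambda>n. c * h n))"
      by (rule mult_left_mono) simp
    then have "norm c * qnorm p h \<le> qnorm p (\<lambda>n. c * h n)"
      using False by (simp add: norm_inverse mult.assoc[symmetric])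
    with le[OF assms, of c] show ?thesis by simp
  qed (simp add: qnorm_0)
qed

lemma representable_diff:
  fixes h g :: "nat \<Rightarrow> 'k::{real_normed_field, banach}"
  assumes "representable p h" "representable p g"
  shows "representable p (\<lambda>n. h n - g n)"
  using representable_add[OF assms(1) representable_scale[OF assms(2), of "- 1"]] by simp

lemma qnorm_minus_commute:
  fixes h g :: "nat \<Rightarrow> 'k::{real_normed_field, banach}"
  assumes "representable p h" "representable p g"
  shows "qnorm p (\<lambda>n. h n - g n) = qnorm p (\<lambda>n. g n - h n)"
  using qnorm_scale[OF representable_diff[OF assms], of "- 1"] by simp

lemma qnorm_triangle:
  fixes h g f :: "nat \<Rightarrow> 'k::{real_normed_field, banach}"
  assumes "representable p h" "representable p g" "representable p f"
  shows "qnorm p (\<lambda>n. h n - f n) \<le> qnorm p (\<lambda>n. h n - g n) + qnorm p (\<lambda>n. g n - f n)"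
  using qnorm_add_le[OF representable_diff[OF assms(1,2)] representable_diff[OF assms(2,3)]] by simp

lemma representable_trunc: "representable p h \<Longrightarrow> representable p (trunc m h)"
  unfolding representable_def using represents_trunc by blast

lemma qnorm_trunc_le: "representable p h \<Longrightarrow> qnorm p (trunc m h) \<le> qnorm p h"
  by (rule le_qnormI) (auto intro: qnorm_le represents_trunc)

lemma qspace_representable: "h \<in> qspace p \<Longrightarrow> representable p h"
  by (simp add: qspace_def)

section \<open>The closure of the finitely supported sequences\<close>

lemma finite_support_in_qspace:
  fixes b :: "nat \<Rightarrow> 'k::real_normed_vector"
  assumes "finite A" "\<And>n. n \<notin> A \<Longrightarrow> b n = 0"
  shows "b \<in> qspace p"
proof -
  obtain N where N: "\<forall>n\<in>A. n < N" using assms(1) finite_nat_set_iff_bounded by blast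
  have "qnorm p (\<lambda>n. b n - trunc m b n) = 0" if "m \<ge> N" for m
  proof -
    have "b n - trunc m b n = 0" for n
      using N that assms(2)[of n] by (auto simp: trunc_def) (meson le_less_trans not_le)
    then show ?thesis by (simp add: qnorm_0)
  qed
  then have "(\<lambda>m. qnorm p (\<lambda>n. b n - trunc m b n)) \<longlonglongrightarrow> 0"
    by (intro tendsto_eventually eventually_sequentiallyI[of N])
  then show ?thesis
    using representable_finite[OF assms] by (simp add: qspace_def)
qed

lemma qspace_add:
  fixes h g :: "nat \<Rightarrow> 'k::{real_normed_field, banach}"
  assumes "h \<in> qspace p" "g \<in> qspace p"
  shows "(\<lambda>n. h n + g n) \<in> qspace p"
proof -
  note r = qspace_representable[OF assms(1)] qspace_representable[OF assms(2)]
  have le: "qnorm p (\<lambda>n. h n + g n - trunc m (\<lambda>n. h n + g n) n)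
      \<le> qnorm p (\<lambda>n. h n - trunc m h n) + qnorm p (\<lambda>n. g n - trunc m g n)" for m
  proof -
    have "(\<lambda>n. h n + g n - trunc m (\<lambda>n. h n + g n) n) = (\<lambda>n. (h n - trunc m h n) + (g n - trunc m g n))"
      by (auto simp: trunc_def)
    then show ?thesis
      using qnorm_add_le[OF representable_diff[OF r(1) representable_trunc[OF r(1)]]
        representable_diff[OF r(2) representable_trunc[OF r(2)]], of m m] by simp
  qed
  have lim: "(\<lambda>m. qnorm p (\<lambda>n. h n - trunc m h n) + qnorm p (\<lambda>n. g n - trunc m g n)) \<longlonglongrightarrow> 0"
    using assms by (intro tendsto_add_zero) (auto simp: qspace_def)
  have nn: "0 \<le> qnorm p (\<lambda>n. h n + g n - trunc m (\<lambda>n. h n + g n) n)" for m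
    by (rule qnorm_nonneg[OF representable_diff[OF representable_add[OF r] representable_trunc[OF representable_add[OF r]]]])
  have "(\<lambda>m. qnorm p (\<lambda>n. h n + g n - trunc m (\<lambda>n. h n + g n) n)) \<longlonglongrightarrow> 0"
  proof (rule Lim_null_comparison[OF always_eventually lim], rule allI)
    fix m
    show "norm (qnorm p (\<lambda>n. h n + g n - trunc m (\<lambda>n. h n + g n) n))
        \<le> qnorm p (\<lambda>n. h n - trunc m h n) + qnorm p (\<lambda>n. g n - trunc m g n)"
      using le[of m] nn[of m] by simp
  qed
  then show ?thesis
    using representable_add[OF r] by (simp add: qspace_def)
qed

lemma qspace_scale:
  fixes c :: "'k::{real_normed_field, banach}"
  assumes "h \<in> qspace p"
  shows "(\<lambda>n. c * h n) \<in> qspace p"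
proof -
  note r = qspace_representable[OF assms]
  have "qnorm p (\<lambda>n. c * h n - trunc m (\<lambda>n. c * h n) n) = norm c * qnorm p (\<lambda>n. h n - trunc m h n)" for m
  proof -
    have "(\<lambda>n. c * h n - trunc m (\<lambda>n. c * h n) n) = (\<lambda>n. c * (h n - trunc m h n))"
      by (auto simp: trunc_def)
    then show ?thesis
      using qnorm_scale[OF representable_diff[OF r representable_trunc[OF r]], of c m] by simp
  qed
  moreover have "(\<lambda>m. norm c * qnorm p (\<lambda>n. h n - trunc m h n)) \<longlonglongrightarrow> norm c * 0"
    using assms by (intro tendsto_mult tendsto_const) (auto simp: qspace_def)
  ultimately show ?thesis
    using representable_scale[OF r] by (simp add: qspace_def)
qed

text \<open>A three-epsilon argument: f is near some \<open>F i\<close>, which is near its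
  truncation, which is near the truncation of f by contractivity.\<close>

lemma qspace_closed:
  fixes F :: "nat \<Rightarrow> nat \<Rightarrow> 'k::{real_normed_field, banach}"
  assumes F: "\<And>i. F i \<in> qspace p" and f: "representable p f"
    and lim: "(\<lambda>i. qnorm p (\<lambda>n. F i n - f n)) \<longlonglongrightarrow> 0"
  shows "f \<in> qspace p"
proof -
  have "(\<lambda>m. qnorm p (\<lambda>n. f n - trunc m f n)) \<longlonglongrightarrow> 0"
  proof (rule LIMSEQ_I)
    fix e :: real assume e: "e > 0"
    note rF = qspace_representable[OF F]
    obtain i where "\<forall>j\<ge>i. norm (qnorm p (\<lambda>n. F j n - f n) - 0) < e / 3"
      using LIMSEQ_D[OF lim, of "e / 3"] e by auto
    then have "norm (qnorm p (\<lambda>n. F i n - f n) - 0) < e / 3" by blast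
    then have i: "qnorm p (\<lambda>n. F i n - f n) < e / 3" by (simp add: abs_less_iff)
    have "(\<lambda>m. qnorm p (\<lambda>n. F i n - trunc m (F i) n)) \<longlonglongrightarrow> 0"
      using F[of i] by (simp add: qspace_def)
    from LIMSEQ_D[OF this, of "e / 3"] e obtain N
      where N: "\<And>m. m \<ge> N \<Longrightarrow> qnorm p (\<lambda>n. F i n - trunc m (F i) n) < e / 3" by fastforce
    have "norm (qnorm p (\<lambda>n. f n - trunc m f n) - 0) < e" if "m \<ge> N" for m
    proof -
      have "qnorm p (\<lambda>n. f n - trunc m f n) \<le> qnorm p (\<lambda>n. f n - F i n)
          + (qnorm p (\<lambda>n. F i n - trunc m (F i) n) + qnorm p (\<lambda>n. trunc m (F i) n - trunc m f n))"
        using qnorm_triangle[OF f rF[of i] representable_trunc[OF f], of m]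
          qnorm_triangle[OF rF[of i] representable_trunc[OF rF[of i]] representable_trunc[OF f], of m m]
        by simp
      moreover have "qnorm p (\<lambda>n. trunc m (F i) n - trunc m f n) \<le> qnorm p (\<lambda>n. F i n - f n)"
      proof -
        have "(\<lambda>n. trunc m (F i) n - trunc m f n) = trunc m (\<lambda>n. F i n - f n)"
          by (auto simp: trunc_def)
        then show ?thesis using qnorm_trunc_le[OF representable_diff[OF rF f]] by simp
      qed
      moreover have "0 \<le> qnorm p (\<lambda>n. f n - trunc m f n)"
        by (intro qnorm_nonneg representable_diff f representable_trunc)
      ultimately show ?thesis
        using i N[OF that] qnorm_minus_commute[OF f rF[of i]] by simp
    qed
    then show "\<exists>N. \<forall>m\<ge>N. norm (qnorm p (\<lambda>n. f n - trunc m f n) - 0) < e" by blast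
  qed
  with f show ?thesis by (simp add: qspace_def)
qed

text \<open>A subsequence with increments of cost (1/2)^k is summed as a series;
  \<open>represents_suminf\<close> bounds the tails, and the Cauchy property carries over the full
  sequence.\<close>

lemma Cauchy_limit_exists:
  fixes F :: "nat \<Rightarrow> nat \<Rightarrow> 'k::{real_normed_field, banach}"
  assumes F: "\<And>i. representable p (F i)"
    and C: "\<And>e. e > 0 \<Longrightarrow> \<exists>M. \<forall>i\<ge>M. \<forall>j\<ge>M. qnorm p (\<lambda>n. F i n - F j n) < e"
  shows "\<exists>f. representable p f \<and> (\<lambda>i. qnorm p (\<lambda>n. F i n - f n)) \<longlonglongrightarrow> 0"
proof -
  have "\<forall>k. \<exists>M. \<forall>i\<ge>M. \<forall>j\<ge>M. qnorm p (\<lambda>n. F i n - F j n) < (1 / 2) ^ k"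
    by (intro allI C) simp
  then obtain N where N: "\<And>k i j. i \<ge> N k \<Longrightarrow> j \<ge> N k \<Longrightarrow> qnorm p (\<lambda>n. F i n - F j n) < (1 / 2) ^ k"
    by metis
  \<comment> \<open>Partial sums of \<open>N\<close> give indices that are monotone and dominate
    \<open>N k\<close>.\<close>
  define \<sigma> where "\<sigma> k = (\<Sum>i\<le>k. N i)" for k
  have \<sigma>: "N k \<le> \<sigma> k" "\<sigma> k \<le> \<sigma> (Suc k)" for k
    by (auto simp: \<sigma>_def intro: member_le_sum)
  define g where "g k n = F (\<sigma> (Suc k)) n - F (\<sigma> k) n" for k n
  have g: "represents p (g k) ((1 / 2) ^ k)" for k
  proof (rule qnorm_less_represents)
    show "representable p (g k)"
      unfolding g_def by (rule representable_diff[OF F F])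
    show "qnorm p (g k) < (1 / 2) ^ k"
      unfolding g_def using N[of k "\<sigma> (Suc k)" "\<sigma> k"] \<sigma>[of k] by linarith
  qed
  have smg: "summable (\<lambda>k. g k n)" for n
  proof (rule summable_comparison_test')
    show "summable (\<lambda>k. (1 / 2 :: real) ^ k)" by (rule summable_geometric) simp
    show "norm (g k n) \<le> (1 / 2) ^ k" if "k \<ge> 0" for k
      by (rule norm_le_represents[OF p g])
  qed
  define f where "f n = F (\<sigma> 0) n + (\<Sum>k. g k n)" for n
  have tail: "represents p (\<lambda>n. f n - F (\<sigma> M) n) (2 * (1 / 2) ^ M)" for M
  proof -
    have "(\<Sum>k<M. g k n) = F (\<sigma> M) n - F (\<sigma> 0) n" for n
      unfolding g_def by (rule sum_lessThan_telescope)
    then have "f n - F (\<sigma> M) n = (\<Sum>k. g (k + M) n)" for n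
      unfolding f_def using suminf_split_initial_segment[OF smg[of n], of M] by simp
    moreover have "(\<Sum>k. (1 / 2) ^ (k + M)) = (2 * (1 / 2) ^ M :: real)"
      by (simp add: power_add suminf_mult2[symmetric] suminf_geometric)
    moreover have "summable (\<lambda>k. (1 / 2 :: real) ^ (k + M))"
      by (simp add: power_add summable_mult2 summable_geometric)
    ultimately show ?thesis
      using represents_suminf[OF p g, of "\<lambda>k. k + M"] by simp
  qed
  have rf: "representable p f"
  proof -
    have "representable p (\<lambda>n. f n - F (\<sigma> 0) n)"
      using tail[of 0] by (auto simp: representable_def)
    from representable_add[OF this F[of "\<sigma> 0"]] show ?thesis by simp
  qed
  have "(\<lambda>i. qnorm p (\<lambda>n. F i n - f n)) \<longlonglongrightarrow> 0"
  proof (rule LIMSEQ_I)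
    fix e :: real assume e: "e > 0"
    obtain M where M: "(1 / 2) ^ M < e / 3"
      using real_arch_pow_inv[of "e / 3" "1 / 2"] e by auto
    have "norm (qnorm p (\<lambda>n. F i n - f n) - 0) < e" if "i \<ge> \<sigma> M" for i
    proof -
      have "qnorm p (\<lambda>n. F i n - f n) \<le> qnorm p (\<lambda>n. F i n - F (\<sigma> M) n) + qnorm p (\<lambda>n. F (\<sigma> M) n - f n)"
        by (intro qnorm_triangle F rf)
      moreover have "qnorm p (\<lambda>n. F i n - F (\<sigma> M) n) < (1 / 2) ^ M"
        using \<sigma>(1)[of M] that by (intro N) auto
      moreover have "qnorm p (\<lambda>n. F (\<sigma> M) n - f n) \<le> 2 * (1 / 2) ^ M"
        unfolding qnorm_minus_commute[OF F rf] by (intro qnorm_le tail)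
      moreover have "0 \<le> qnorm p (\<lambda>n. F i n - f n)"
        by (intro qnorm_nonneg representable_diff F rf)
      ultimately show ?thesis using M by simp
    qed
    then show "\<exists>N. \<forall>i\<ge>N. norm (qnorm p (\<lambda>n. F i n - f n) - 0) < e" by blast
  qed
  with rf show ?thesis by blast
qed

end

section \<open>The unit vector basis\<close>

definition scale_fun :: "'k::times \<Rightarrow> (nat \<Rightarrow> 'k) \<Rightarrow> nat \<Rightarrow> 'k" where
  "scale_fun c f = (\<lambda>n. c * f n)"

definition unit_vec :: "nat \<Rightarrow> nat \<Rightarrow> 'k::zero_neq_one" where
  "unit_vec n = (\<lambda>k. if k = n then 1 else 0)"

definition restr :: "(nat \<Rightarrow> 'k::zero) \<Rightarrow> nat set \<Rightarrow> nat \<Rightarrow> 'k" where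
  "restr a A = (\<lambda>n. if n \<in> A then a n else 0)"

lemma lin_comb_unit_vec:
  fixes a :: "nat \<Rightarrow> 'k::comm_ring_1"
  shows "finite A \<Longrightarrow> lin_comb scale_fun unit_vec a A = restr a A"
  unfolding lin_comb_def
  by (induction A rule: finite_induct)
    (auto simp: restr_def scale_fun_def unit_vec_def fun_eq_iff)

lemma sum_unit_vec:
  "finite A \<Longrightarrow> (\<Sum>n\<in>A. unit_vec n :: nat \<Rightarrow> 'k::comm_ring_1) = restr (\<lambda>n. 1) A"
  by (induction A rule: finite_induct) (auto simp: restr_def unit_vec_def fun_eq_iff)

lemma restr_lessThan: "restr a {..<m} = trunc m a"
  by (auto simp: restr_def trunc_def)

text \<open>Turns the cardinality bounds into norm bounds. The cost is linear in \<beta> but of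
  order p in \<alpha>; r \<ge> 1 gives \<beta> \<le> r \<le> r^p and reconciles the two.\<close>

lemma powr_inverse_le_of_cost:
  fixes p :: real
  assumes "1 \<le> p" "0 \<le> \<alpha>" "0 \<le> \<beta>" "\<alpha> + \<beta> \<le> r" "1 \<le> r" "0 \<le> C" "0 \<le> c" "c \<le> C * (\<alpha> powr p + \<beta>)"
  shows "c powr (1 / p) \<le> (2 * C) powr (1 / p) * r"
proof -
  have "\<alpha> powr p \<le> r powr p" using assms by (intro powr_mono2) auto
  moreover have "\<beta> \<le> r powr 1" using assms by simp
  moreover have "r powr 1 \<le> r powr p" using assms by (intro powr_mono) auto
  ultimately have "C * (\<alpha> powr p + \<beta>) \<le> C * (r powr p + r powr p)"
    using assms by (intro mult_left_mono add_mono) auto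
  then have "c \<le> 2 * C * r powr p" using assms by simp
  then have "c powr (1 / p) \<le> (2 * C * r powr p) powr (1 / p)"
    using assms by (intro powr_mono2) auto
  also have "\<dots> = (2 * C) powr (1 / p) * (r powr p) powr (1 / p)"
    by (simp only: powr_mult)
  also have "(r powr p) powr (1 / p) = r"
    using assms by (simp add: powr_powr)
  finally show ?thesis .
qed

text \<open>This is the crossover region of the weight: with \<open>val2 n \<ge> 2j\<close> and n <
  2^(3j+1) the first term is at least 2^(-(4j+2)/(8p)) and the second at least 1/4.\<close>

lemma weight_ge_of_dvd:
  assumes p: "1 \<le> p" and n: "0 < n" "n < 2 ^ (3 * j + 1)" "2 ^ (2 * j) dvd n"
  shows "2 powr (- real j / (2 * p)) / 4 \<le> weight p n"
proof -
  have v: "2 * j \<le> val2 n"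
    using n by (intro multiplicity_geI) auto
  have n2: "real n ^ 2 \<le> 4 * 2 ^ (6 * j)"
  proof -
    have "real n \<le> 2 ^ (3 * j + 1)"
      using n(2) by (metis less_imp_le of_nat_less_iff of_nat_numeral of_nat_power)
    then have "real n ^ 2 \<le> (2 ^ (3 * j + 1)) ^ 2" by (intro power_mono) auto
    then show ?thesis by (simp add: power_mult[symmetric] power_mult_distrib mult.commute)
  qed
  have q: "c / (4 * 2 ^ (6 * j)) \<le> d / real n ^ 2" if "0 \<le> c" "c \<le> d" for c d
    using n2 that n(1) by (intro frac_le) auto
  have "2 powr (- real j / (2 * p)) / 4 = 2 powr (- real j / (2 * p) - 2)"
    by (simp add: powr_diff powr_numeral)
  also have "\<dots> \<le> 2 powr ((- (4 * real j) - 2) * (1 / (8 * p)))"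
    using p by (intro powr_mono) (auto simp: field_simps)
  also have "\<dots> = (2 powr (- (4 * real j) - 2)) powr (1 / (8 * p))"
    by (simp only: powr_powr)
  also have "2 powr (- (4 * real j) - 2) = 2 ^ (2 * j) / (4 * 2 ^ (6 * j))"
  proof -
    have "2 powr (- (4 * real j) - 2) = 2 powr (real (2 * j) - (2 + real (6 * j)))"
      by (rule arg_cong[where f = "(powr) 2"]) simp
    also have "\<dots> = 2 powr real (2 * j) / (2 powr 2 * 2 powr real (6 * j))"
      by (simp only: powr_diff powr_add)
    also have "\<dots> = 2 ^ (2 * j) / (4 * 2 ^ (6 * j))"
      by (simp only: powr_realpow) (simp add: powr_numeral)
    finally show ?thesis .
  qed
  also have "(2 ^ (2 * j) / (4 * 2 ^ (6 * j))) powr (1 / (8 * p)) \<le> (2 ^ val2 n / real n ^ 2) powr (1 / (8 * p))"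
    using p v by (intro powr_mono2 q power_increasing) auto
  finally have 1: "2 powr (- real j / (2 * p)) / 4 \<le> (2 ^ val2 n / real n ^ 2) powr (1 / (8 * p))" .
  have "2 powr (- real j / (2 * p)) \<le> 2 powr 0"
    using p by (intro powr_mono) auto
  then have "2 powr (- real j / (2 * p)) / 4 \<le> 2 ^ (6 * j) / (4 * 2 ^ (6 * j))" by simp
  also have "\<dots> \<le> 8 ^ val2 n / real n ^ 2"
  proof (rule q)
    have "(2::real) ^ (6 * j) = 8 ^ (2 * j)"
      by (simp add: power_mult)
    also have "\<dots> \<le> 8 ^ val2 n" using v by (intro power_increasing) auto
    finally show "(2::real) ^ (6 * j) \<le> 8 ^ val2 n" .
  qed simp
  finally show ?thesis using 1 by (simp add: weight_def)
qed

section \<open>Norm estimates by cardinality\<close>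

context
  fixes p :: real
  assumes p: "1 \<le> p"
begin

lemma qnorm_restr_le:
  fixes b :: "nat \<Rightarrow> 'k::real_normed_vector"
  assumes "finite A" "\<And>n. n \<in> A \<Longrightarrow> norm (b n) \<le> M" "0 \<le> M"
  shows "qnorm p (restr b A) \<le> M * real (card A) powr (1 / p)"
  using assms by (intro qnorm_le[OF p] represents_finite_support[OF p]) (auto simp: restr_def)

lemma restr_in_qspace:
  fixes b :: "nat \<Rightarrow> 'k::real_normed_vector"
  shows "finite A \<Longrightarrow> restr b A \<in> qspace p"
  by (rule finite_support_in_qspace[OF p, of A]) (auto simp: restr_def)

text \<open>Homogeneity reduces a lower estimate to \<mu> = 1, and the bound for every
  representation passes to the infimum. The case \<mu> = 0 is trivial, so the assumed bound is
  restricted to \<mu> > 0.\<close>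

lemma le_qnorm_of_unit_bound:
  fixes f :: "nat \<Rightarrow> 'k::real_normed_field"
  assumes "representable p f" "0 \<le> \<mu>" "0 \<le> c"
    and unit: "\<And>r. 0 < \<mu> \<Longrightarrow> represents p (\<lambda>n. of_real (1 / \<mu>) * f n) r \<Longrightarrow> x \<le> c * r"
  shows "\<mu> * x \<le> c * qnorm p f"
proof (cases "\<mu> = 0")
  case True
  then show ?thesis using qnorm_nonneg[OF p assms(1)] assms(3) by simp
next
  case False
  with assms(2) have \<mu>: "\<mu> > 0" by simp
  have le: "\<mu> * x \<le> c * r" if "represents p f r" for r
  proof -
    have "x \<le> c * (norm (of_real (1 / \<mu>) :: 'k) * r)"
      using unit[OF \<mu> represents_scale[OF that]] .
    then show ?thesis using \<mu> by (simp add: norm_divide field_simps)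
  qed
  show ?thesis
  proof (cases "c = 0")
    case True
    then show ?thesis using le assms(1) by (auto simp: representable_def)
  next
    case False
    with assms(3) have c: "c > 0" by simp
    have "\<mu> * x / c \<le> qnorm p f"
      using le c by (intro le_qnormI[OF p assms(1)]) (simp add: field_simps)
    then show ?thesis using c by (simp add: field_simps)
  qed
qed

text \<open>The norm form of \<open>card_le_of_unimodular\<close>, used for QGLC.\<close>

lemma le_qnorm_of_constant_modulus:
  obtains C where "C \<ge> 0"
    "\<And>(f :: nat \<Rightarrow> 'k::{real_normed_field, banach}) A \<mu>. representable p f \<Longrightarrow> finite A \<Longrightarrow> 0 \<le> \<mu> \<Longrightarrow>
      (\<And>n. n \<in> A \<Longrightarrow> norm (f n) = \<mu>) \<Longrightarrow> (\<And>n. norm (f n) \<le> \<mu>) \<Longrightarrow>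
      \<mu> * real (card A) powr (1 / p) \<le> C * qnorm p f"
proof -
  obtain C where C: "C \<ge> 0"
    "\<And>(u :: nat \<Rightarrow> 'k) w \<alpha> \<beta> A. weak_bound p u \<alpha> \<Longrightarrow> bv_bound w \<beta> \<Longrightarrow> finite A \<Longrightarrow>
      (\<And>n. n \<in> A \<Longrightarrow> norm (u n + weight p n *\<^sub>R w n) = 1) \<Longrightarrow>
      (\<And>n. norm (u n + weight p n *\<^sub>R w n) \<le> 1) \<Longrightarrow> real (card A) \<le> C * (\<alpha> powr p + \<beta>)"
    using card_le_of_unimodular[where 'k = 'k, OF p] by blast
  have unit: "real (card A) powr (1 / p) \<le> ((2 * C) powr (1 / p)) * r"
    if f: "represents p f r" "finite A" "\<And>n. n \<in> A \<Longrightarrow> norm (f n) = 1" "\<And>n. norm (f n) \<le> 1"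
    for f :: "nat \<Rightarrow> 'k" and A r
  proof (cases "A = {}")
    case True
    then show ?thesis using represents_nonneg[OF p f(1)] by simp
  next
    case False
    then obtain n where "n \<in> A" by blast
    \<comment> \<open>A coordinate of modulus 1 forces cost at least 1, as
      \<open>powr_inverse_le_of_cost\<close> requires.\<close>
    then have r: "1 \<le> r" using norm_le_represents[OF p f(1), of n] f(3) by simp
    obtain u w \<alpha> \<beta> where h: "weak_bound p u \<alpha>" "bv_bound w \<beta>" "\<alpha> + \<beta> \<le> r" "\<And>n. f n = u n + weight p n *\<^sub>R w n"
      using f(1) unfolding represents_def by blast
    have "real (card A) \<le> C * (\<alpha> powr p + \<beta>)"
      using f(3,4) h(4) by (intro C(2)[OF h(1,2) f(2)]) auto
    then show ?thesis
      using weak_bound_nonneg[OF h(1)] bv_bound_nonneg[OF h(2)] h(3) r C(1)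
      by (intro powr_inverse_le_of_cost[OF p, of \<alpha> \<beta>]) auto
  qed
  show thesis
  proof (rule that[of "(2 * C) powr (1 / p)"])
    fix f :: "nat \<Rightarrow> 'k" and A \<mu>
    assume f: "representable p f" "finite A" "0 \<le> \<mu>" "\<And>n. n \<in> A \<Longrightarrow> norm (f n) = \<mu>" "\<And>n. norm (f n) \<le> \<mu>"
    show "\<mu> * real (card A) powr (1 / p) \<le> (2 * C) powr (1 / p) * qnorm p f"
      using f by (intro le_qnorm_of_unit_bound unit) (auto simp: norm_mult norm_divide)
  qed simp
qed

text \<open>The norm form of \<open>card_le_of_support\<close>. Together with the upper bound
  \<open>qnorm_restr_le\<close> it gives LUCC, LPU, democracy and the fundamental function.\<close>

lemma le_qnorm_of_support:
  obtains C where "C \<ge> 0"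
    "\<And>(f :: nat \<Rightarrow> 'k::{real_normed_field, banach}) A \<mu>. finite A \<Longrightarrow> 0 \<le> \<mu> \<Longrightarrow>
      (\<And>n. n \<in> A \<Longrightarrow> \<mu> \<le> norm (f n)) \<Longrightarrow> \<mu> * real (card A) powr (1 / p) \<le> C * qnorm p (restr f A)"
proof -
  obtain C where C: "C \<ge> 0"
    "\<And>(u :: nat \<Rightarrow> 'k) w \<alpha> \<beta> A. weak_bound p u \<alpha> \<Longrightarrow> bv_bound w \<beta> \<Longrightarrow> finite A \<Longrightarrow>
      (\<And>n. n \<in> A \<Longrightarrow> 1 \<le> norm (u n + weight p n *\<^sub>R w n)) \<Longrightarrow>
      (\<And>n. n \<notin> A \<Longrightarrow> u n + weight p n *\<^sub>R w n = 0) \<Longrightarrow> real (card A) \<le> C * (\<alpha> powr p + \<beta>)"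
    using card_le_of_support[where 'k = 'k, OF p] by blast
  have unit: "real (card A) powr (1 / p) \<le> ((2 * C) powr (1 / p)) * r"
    if f: "represents p f r" "finite A" "\<And>n. n \<in> A \<Longrightarrow> 1 \<le> norm (f n)" "\<And>n. n \<notin> A \<Longrightarrow> f n = 0"
    for f :: "nat \<Rightarrow> 'k" and A r
  proof (cases "A = {}")
    case True
    then show ?thesis using represents_nonneg[OF p f(1)] by simp
  next
    case False
    then obtain n where "n \<in> A" by blast
    then have r: "1 \<le> r" using norm_le_represents[OF p f(1), of n] f(3)[of n] by simp
    obtain u w \<alpha> \<beta> where h: "weak_bound p u \<alpha>" "bv_bound w \<beta>" "\<alpha> + \<beta> \<le> r" "\<And>n. f n = u n + weight p n *\<^sub>R w n"
      using f(1) unfolding represents_def by blast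
    have "real (card A) \<le> C * (\<alpha> powr p + \<beta>)"
      using f(3,4) unfolding h(4) by (intro C(2)[OF h(1,2) f(2)]) auto
    then show ?thesis
      using weak_bound_nonneg[OF h(1)] bv_bound_nonneg[OF h(2)] h(3) r C(1)
      by (intro powr_inverse_le_of_cost[OF p, of \<alpha> \<beta>]) auto
  qed
  show thesis
  proof (rule that[of "(2 * C) powr (1 / p)"])
    fix f :: "nat \<Rightarrow> 'k" and A \<mu>
    assume f: "finite A" "0 \<le> \<mu>" "\<And>n. n \<in> A \<Longrightarrow> \<mu> \<le> norm (f n)"
    define g where "g = restr f A"
    have g: "representable p g" "\<And>n. n \<in> A \<Longrightarrow> \<mu> \<le> norm (g n)" "\<And>n. n \<notin> A \<Longrightarrow> g n = 0"
      using qspace_representable[OF p restr_in_qspace[OF f(1)]] f(3) by (auto simp: g_def restr_def)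
    have "\<mu> * real (card A) powr (1 / p) \<le> (2 * C) powr (1 / p) * qnorm p g"
      using f(1,2) g
      by (intro le_qnorm_of_unit_bound unit[where f = "\<lambda>n. of_real (1 / \<mu>) * g n"])
        (auto simp: norm_mult norm_divide)
    then show "\<mu> * real (card A) powr (1 / p) \<le> (2 * C) powr (1 / p) * qnorm p (restr f A)"
      by (simp add: g_def)
  qed simp
qed

end

section \<open>The Banach space and its Schauder basis\<close>

lemma vector_space_scale_fun: "vector_space (scale_fun :: 'k::field \<Rightarrow> (nat \<Rightarrow> 'k) \<Rightarrow> nat \<Rightarrow> 'k)"
  by unfold_locales (auto simp: scale_fun_def algebra_simps)

lemma banach_space_on_qspace:
  assumes p: "1 \<le> p"
  shows "banach_space_on scale_fun (qspace p :: (nat \<Rightarrow> 'k::{real_normed_field, banach}) set) (qnorm p)"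
proof -
  interpret V: vector_space "scale_fun :: 'k \<Rightarrow> (nat \<Rightarrow> 'k) \<Rightarrow> nat \<Rightarrow> 'k"
    by (rule vector_space_scale_fun)
  have plus: "f + g = (\<lambda>n. f n + g n)" "f - g = (\<lambda>n. f n - g n)" for f g :: "nat \<Rightarrow> 'k"
    by auto
  note rep = qspace_representable[OF p]
  show ?thesis
  proof (intro banach_space_on.intro vector_space_scale_fun banach_space_on_axioms.intro)
    show "V.subspace (qspace p)"
    proof (rule V.subspaceI)
      show "(0 :: nat \<Rightarrow> 'k) \<in> qspace p"
        by (rule finite_support_in_qspace[OF p, of "{}"]) auto
    qed (auto simp: plus scale_fun_def qspace_add[OF p] qspace_scale[OF p])
    show "0 \<le> qnorm p f" if "f \<in> qspace p" for f :: "nat \<Rightarrow> 'k"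
      using qnorm_nonneg[OF p rep[OF that]] .
    show "qnorm p f = 0 \<longleftrightarrow> f = 0" if "f \<in> qspace p" for f :: "nat \<Rightarrow> 'k"
    proof
      assume "qnorm p f = 0"
      then have "f n = 0" for n using norm_le_qnorm[OF p rep[OF that], of n] by simp
      then show "f = 0" by auto
    next
      assume "f = 0"
      then show "qnorm p f = 0" using qnorm_0[OF p] by (simp add: zero_fun_def)
    qed
    show "qnorm p (scale_fun c f) = norm c * qnorm p f" if "f \<in> qspace p" for f :: "nat \<Rightarrow> 'k" and c
      unfolding scale_fun_def using qnorm_scale[OF p rep[OF that]] .
    show "qnorm p (f + g) \<le> qnorm p f + qnorm p g" if "f \<in> qspace p" "g \<in> qspace p" for f g :: "nat \<Rightarrow> 'k"
      unfolding plus using qnorm_add_le[OF p rep[OF that(1)] rep[OF that(2)]] .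
    show "\<exists>f\<in>qspace p. (\<lambda>i. qnorm p (F i - f)) \<longlonglongrightarrow> 0"
      if FX: "\<forall>i. F i \<in> qspace p" and Cau: "\<forall>e>0. \<exists>M. \<forall>i\<ge>M. \<forall>j\<ge>M. qnorm p (F i - F j) < e" for F :: "nat \<Rightarrow> nat \<Rightarrow> 'k"
    proof -
      have F: "F i \<in> qspace p" for i using FX by blast
      have "\<exists>M. \<forall>i\<ge>M. \<forall>j\<ge>M. qnorm p (\<lambda>n. F i n - F j n) < e" if "e > 0" for e
        using Cau that unfolding plus by simp
      then obtain f where f: "representable p f" "(\<lambda>i. qnorm p (\<lambda>n. F i n - f n)) \<longlonglongrightarrow> 0"
        using Cauchy_limit_exists[OF p, of F] rep[OF F] by auto
      have "f \<in> qspace p" by (rule qspace_closed[OF p F f])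
      moreover have "(\<lambda>i. qnorm p (F i - f)) \<longlonglongrightarrow> 0" using f(2) unfolding plus .
      ultimately show ?thesis by blast
    qed
  qed
qed

context
  fixes p :: real
  assumes p: "1 \<le> p"
begin

text \<open>Coordinate n of a partial sum is \<open>a n\<close> once m > n, and coordinates are
  contractive, so convergence forces \<open>a = f\<close>. The converse is the definition of
  \<open>qspace\<close>.\<close>

lemma is_expansion_iff:
  fixes f :: "nat \<Rightarrow> 'k::{real_normed_field, banach}"
  assumes f: "f \<in> qspace p"
  shows "is_expansion scale_fun (qnorm p) unit_vec f a \<longleftrightarrow> a = f"
proof -
  have eq: "qnorm p (f - lin_comb scale_fun unit_vec a {..<m}) = qnorm p (\<lambda>n. f n - trunc m a n)" for m
    by (simp add: lin_comb_unit_vec restr_lessThan fun_diff_def)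
  show ?thesis
    unfolding is_expansion_def eq
  proof
    assume lim: "(\<lambda>m. qnorm p (\<lambda>n. f n - trunc m a n)) \<longlonglongrightarrow> 0"
    show "a = f"
    proof
      fix n
      have "norm (f n - a n) \<le> qnorm p (\<lambda>n. f n - trunc m a n)" if "m \<ge> Suc n" for m
      proof -
        have "trunc m a \<in> qspace p"
          by (rule finite_support_in_qspace[OF p, of "{..<m}"]) (auto simp: trunc_def)
        then have "representable p (\<lambda>n. f n - trunc m a n)"
          using f by (intro representable_diff[OF p] qspace_representable[OF p])
        from norm_le_qnorm[OF p this, of n] show ?thesis
          using that by (simp add: trunc_def)
      qed
      then have "norm (f n - a n) \<le> 0"
        by (intro LIMSEQ_le_const[OF lim]) blast
      then show "a n = f n" by simp
    qed
  next
    assume "a = f"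
    then show "(\<lambda>m. qnorm p (\<lambda>n. f n - trunc m a n)) \<longlonglongrightarrow> 0"
      using f by (simp add: qspace_def)
  qed
qed

lemma unit_vec_in_qspace: "(unit_vec n :: nat \<Rightarrow> 'k::real_normed_field) \<in> qspace p"
  by (rule finite_support_in_qspace[OF p, of "{n}"]) (auto simp: unit_vec_def)

lemma schauder_basis_unit_vec:
  "schauder_basis scale_fun (qspace p :: (nat \<Rightarrow> 'k::{real_normed_field, banach}) set) (qnorm p) unit_vec"
  unfolding schauder_basis_def by (auto simp: unit_vec_in_qspace is_expansion_iff)

lemma coord_unit_vec:
  fixes f :: "nat \<Rightarrow> 'k::{real_normed_field, banach}"
  shows "f \<in> qspace p \<Longrightarrow> coord scale_fun (qnorm p) unit_vec f = f"
  unfolding coord_def by (rule the_equality) (simp_all add: is_expansion_iff)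

lemma normalized_unit_vec:
  "normalized (qnorm p) (unit_vec :: nat \<Rightarrow> nat \<Rightarrow> 'k::{real_normed_field, banach})"
  unfolding normalized_def
proof
  fix n
  have "qnorm p (unit_vec n :: nat \<Rightarrow> 'k) \<le> 1 * real (card {n}) powr (1 / p)"
    by (intro qnorm_le[OF p] represents_finite_support[OF p]) (auto simp: unit_vec_def)
  moreover have "norm ((unit_vec n :: nat \<Rightarrow> 'k) n) \<le> qnorm p (unit_vec n :: nat \<Rightarrow> 'k)"
    by (rule norm_le_qnorm[OF p qspace_representable[OF p unit_vec_in_qspace]])
  ultimately show "qnorm p (unit_vec n :: nat \<Rightarrow> 'k) = 1" by (simp add: unit_vec_def)
qed

section \<open>Greedy-type properties of the basis\<close>

lemma QGLC_unit_vec: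
  "QGLC scale_fun (qspace p :: (nat \<Rightarrow> 'k::{real_normed_field, banach}) set) (qnorm p) unit_vec"
proof -
  obtain C where C: "C \<ge> 0"
    "\<And>(f :: nat \<Rightarrow> 'k) A \<mu>. representable p f \<Longrightarrow> finite A \<Longrightarrow> 0 \<le> \<mu> \<Longrightarrow>
      (\<And>n. n \<in> A \<Longrightarrow> norm (f n) = \<mu>) \<Longrightarrow> (\<And>n. norm (f n) \<le> \<mu>) \<Longrightarrow>
      \<mu> * real (card A) powr (1 / p) \<le> C * qnorm p f"
    using le_qnorm_of_constant_modulus[OF p] by blast
  show ?thesis
    unfolding QGLC_def
  proof (intro exI[of _ C] ballI allI impI)
    fix f :: "nat \<Rightarrow> 'k" and A
    assume f: "f \<in> qspace p" and A: "A \<noteq> {}" and gr: "greedy_set scale_fun (qnorm p) unit_vec f A"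
      and osc: "osc scale_fun (qnorm p) unit_vec f A = 1"
    note [simp] = coord_unit_vec[OF f]
    have fin: "finite A" using gr by (simp add: greedy_set_def)
    define \<mu> where "\<mu> = Max ((\<lambda>n. norm (f n)) ` A)"
    define m where "m = Min ((\<lambda>n. norm (f n)) ` A)"
    \<comment> \<open>If m = 0, the convention for \<open>osc\<close> yields the value 1 only when
      the maximum is 0 as well.\<close>
    have "m = \<mu>"
    proof (cases "m = 0")
      case True
      then show ?thesis
        using osc by (auto simp: osc_def Let_def \<mu>_def m_def split: if_splits)
    next
      case False
      then have "ereal (\<mu> / m) = 1"
        using osc by (simp add: osc_def Let_def \<mu>_def m_def)
      then show ?thesis using False by (simp add: one_ereal_def)
    qed
    have eq: "norm (f n) = \<mu>" if "n \<in> A" for n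
    proof (rule antisym)
      show "norm (f n) \<le> \<mu>" unfolding \<mu>_def using fin that by (intro Max_ge) auto
      show "\<mu> \<le> norm (f n)" unfolding \<open>m = \<mu>\<close>[symmetric] m_def using fin that by (intro Min_le) auto
    qed
    obtain k where k: "k \<in> A" using A by blast
    have le: "norm (f n) \<le> \<mu>" for n
      using gr k eq by (cases "n \<in> A") (auto simp: greedy_set_def)
    have \<mu>0: "0 \<le> \<mu>" using le[of 0] norm_ge_zero order_trans by blast
    \<comment> \<open>Greediness makes the common modulus \<mu> on A a bound for all coordinates, so
      both norms compare with \<mu> |A|^(1/p).\<close>
    have "qnorm p (restr f A) \<le> \<mu> * real (card A) powr (1 / p)"
      using fin eq \<mu>0 by (intro qnorm_restr_le[OF p]) auto
    also have "\<dots> \<le> C * qnorm p f"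
      using eq le \<mu>0 by (intro C(2) qspace_representable[OF p f] fin) auto
    finally show "qnorm p (coord_proj scale_fun (qnorm p) unit_vec A f) \<le> C * qnorm p f"
      by (simp add: coord_proj_def lin_comb_unit_vec[OF fin])
  qed
qed

text \<open>The quotient condition gives modulus at least 1 for the coefficients a; then |A|^(1/p)
  separates the two norms.\<close>

lemma LUCC_unit_vec:
  "LUCC scale_fun (qnorm p) (unit_vec :: nat \<Rightarrow> nat \<Rightarrow> 'k::{real_normed_field, banach})"
proof -
  obtain C where C: "C \<ge> 0"
    "\<And>(f :: nat \<Rightarrow> 'k) A \<mu>. finite A \<Longrightarrow> 0 \<le> \<mu> \<Longrightarrow>
      (\<And>n. n \<in> A \<Longrightarrow> \<mu> \<le> norm (f n)) \<Longrightarrow> \<mu> * real (card A) powr (1 / p) \<le> C * qnorm p (restr f A)"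
    using le_qnorm_of_support[OF p] by blast
  show ?thesis
    unfolding LUCC_def
  proof (intro exI[of _ C] allI impI)
    fix A and a b :: "nat \<Rightarrow> 'k"
    assume A: "finite A" and ab: "\<forall>n\<in>A. norm (b n) = 1 \<and> a n / b n \<in> of_real ` {1..}"
    have a: "1 \<le> norm (a n)" if n: "n \<in> A" for n
    proof -
      obtain t where t: "1 \<le> t" "a n / b n = of_real t" using ab n by auto
      have "norm (a n) = norm (a n / b n)" using ab n by (simp add: norm_divide)
      also have "\<dots> = t" using t by simp
      finally show ?thesis using t by simp
    qed
    have "qnorm p (restr b A) \<le> 1 * real (card A) powr (1 / p)"
      using A ab by (intro qnorm_restr_le[OF p]) auto
    also have "\<dots> \<le> C * qnorm p (restr a A)"
      using a by (intro C(2) A) auto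
    finally show "qnorm p (lin_comb scale_fun unit_vec b A) \<le> C * qnorm p (lin_comb scale_fun unit_vec a A)"
      by (simp add: lin_comb_unit_vec[OF A])
  qed
qed

lemma LPU_unit_vec:
  "LPU scale_fun (qnorm p) (unit_vec :: nat \<Rightarrow> nat \<Rightarrow> 'k::{real_normed_field, banach})"
proof -
  obtain C where C: "C \<ge> 0"
    "\<And>(f :: nat \<Rightarrow> 'k) A \<mu>. finite A \<Longrightarrow> 0 \<le> \<mu> \<Longrightarrow>
      (\<And>n. n \<in> A \<Longrightarrow> \<mu> \<le> norm (f n)) \<Longrightarrow> \<mu> * real (card A) powr (1 / p) \<le> C * qnorm p (restr f A)"
    using le_qnorm_of_support[OF p] by blast
  show ?thesis
    unfolding LPU_def
  proof (intro exI[of _ C] allI impI)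
    fix A and a b :: "nat \<Rightarrow> 'k"
    assume A: "finite A" and ab: "(SUP n\<in>A. norm (b n)) \<le> (INF n\<in>A. norm (a n))"
    define \<mu> where "\<mu> = (INF n\<in>A. norm (a n))"
    have "qnorm p (restr b A) \<le> C * qnorm p (restr a A)"
    \<comment> \<open>Over the empty set the real \<open>SUP\<close> and \<open>INF\<close> carry no
      information, but both combinations are 0.\<close>
    proof (cases "A = {}")
      case True
      then show ?thesis by (simp add: restr_def qnorm_0[OF p])
    next
      case False
      then obtain k where k: "k \<in> A" by blast
      have b: "norm (b n) \<le> \<mu>" if "n \<in> A" for n
        using cSUP_upper[OF that, of "\<lambda>n. norm (b n)"] A ab by (auto simp: \<mu>_def intro: order_trans)
      have a: "\<mu> \<le> norm (a n)" if "n \<in> A" for n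
        unfolding \<mu>_def using A that by (intro cINF_lower) auto
      have \<mu>0: "0 \<le> \<mu>" using b[OF k] norm_ge_zero order_trans by blast
      have "qnorm p (restr b A) \<le> \<mu> * real (card A) powr (1 / p)"
        using A b \<mu>0 by (intro qnorm_restr_le[OF p]) auto
      also have "\<dots> \<le> C * qnorm p (restr a A)"
        using a \<mu>0 by (intro C(2) A) auto
      finally show ?thesis .
    qed
    then show "qnorm p (lin_comb scale_fun unit_vec b A) \<le> C * qnorm p (lin_comb scale_fun unit_vec a A)"
      by (simp add: lin_comb_unit_vec[OF A])
  qed
qed

lemma democratic_unit_vec:
  "democratic (qnorm p) (unit_vec :: nat \<Rightarrow> nat \<Rightarrow> 'k::{real_normed_field, banach})"
proof -
  obtain C where C: "C \<ge> 0"
    "\<And>(f :: nat \<Rightarrow> 'k) A \<mu>. finite A \<Longrightarrow> 0 \<le> \<mu> \<Longrightarrow>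
      (\<And>n. n \<in> A \<Longrightarrow> \<mu> \<le> norm (f n)) \<Longrightarrow> \<mu> * real (card A) powr (1 / p) \<le> C * qnorm p (restr f A)"
    using le_qnorm_of_support[OF p] by blast
  show ?thesis
    unfolding democratic_def
  proof (intro exI[of _ C] allI impI)
    fix A B :: "nat set"
    assume A: "finite A" and B: "finite B" and le: "card A \<le> card B"
    have "qnorm p (restr (\<lambda>n. 1 :: 'k) A) \<le> 1 * real (card A) powr (1 / p)"
      using A by (intro qnorm_restr_le[OF p]) auto
    also have "\<dots> \<le> 1 * real (card B) powr (1 / p)"
      using le p by (intro mult_left_mono powr_mono2) auto
    also have "\<dots> \<le> C * qnorm p (restr (\<lambda>n. 1 :: 'k) B)"
      by (intro C(2) B) auto
    finally show "qnorm p (\<Sum>n\<in>A. unit_vec n :: nat \<Rightarrow> 'k) \<le> C * qnorm p (\<Sum>n\<in>B. unit_vec n :: nat \<Rightarrow> 'k)"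
      by (simp add: sum_unit_vec A B)
  qed
qed

lemma fundamental_fun_unit_vec:
  "\<exists>C\<ge>1. \<forall>m\<ge>1.
    real m powr (1 / p) / C \<le> fundamental_fun scale_fun (qnorm p) (unit_vec :: nat \<Rightarrow> nat \<Rightarrow> 'k::{real_normed_field, banach}) m \<and>
    fundamental_fun scale_fun (qnorm p) (unit_vec :: nat \<Rightarrow> nat \<Rightarrow> 'k) m \<le> C * real m powr (1 / p)"
proof -
  obtain C where C: "C \<ge> 0"
    "\<And>(f :: nat \<Rightarrow> 'k) A \<mu>. finite A \<Longrightarrow> 0 \<le> \<mu> \<Longrightarrow>
      (\<And>n. n \<in> A \<Longrightarrow> \<mu> \<le> norm (f n)) \<Longrightarrow> \<mu> * real (card A) powr (1 / p) \<le> C * qnorm p (restr f A)"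
    using le_qnorm_of_support[OF p] by blast
  show ?thesis
  \<comment> \<open>C + 1 is at least 1 and may be divided by; enlarging C is harmless since norms
    are nonnegative.\<close>
  proof (intro exI[of _ "C + 1"] conjI allI impI)
    show "1 \<le> C + 1" using C(1) by simp
    fix m :: nat assume "1 \<le> m"
    define S where "S = {qnorm p (lin_comb scale_fun (unit_vec :: nat \<Rightarrow> nat \<Rightarrow> 'k) \<epsilon> A) | \<epsilon> A.
      finite A \<and> card A \<le> m \<and> (\<forall>n\<in>A. norm (\<epsilon> n) = 1)}"
    have F: "fundamental_fun scale_fun (qnorm p) (unit_vec :: nat \<Rightarrow> nat \<Rightarrow> 'k) m = Sup S"
      by (simp add: fundamental_fun_def S_def)
    have up: "s \<le> real m powr (1 / p)" if s: "s \<in> S" for s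
    proof -
      obtain \<epsilon> :: "nat \<Rightarrow> 'k" and A where A: "finite A" "card A \<le> m" "\<forall>n\<in>A. norm (\<epsilon> n) = 1"
        "s = qnorm p (restr \<epsilon> A)"
        using s unfolding S_def by (auto simp: lin_comb_unit_vec)
      have "s \<le> 1 * real (card A) powr (1 / p)"
        unfolding A(4) using A by (intro qnorm_restr_le[OF p]) auto
      also have "\<dots> \<le> 1 * real m powr (1 / p)"
        using A p by (intro mult_left_mono powr_mono2) auto
      finally show ?thesis by simp
    qed
    let ?s = "qnorm p (restr (\<lambda>n. 1 :: 'k) {..<m})"
    have sS: "?s \<in> S"
      unfolding S_def by (auto intro!: exI[of _ "\<lambda>n. 1 :: 'k"] exI[of _ "{..<m}"] simp: lin_comb_unit_vec)
    have "1 * real (card {..<m}) powr (1 / p) \<le> C * ?s"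
      by (intro C(2)) auto
    moreover have "0 \<le> ?s"
      by (intro qnorm_nonneg[OF p] qspace_representable[OF p] restr_in_qspace[OF p]) simp
    ultimately have "real m powr (1 / p) \<le> (C + 1) * ?s"
      by (simp add: distrib_right)
    then have "real m powr (1 / p) / (C + 1) \<le> ?s"
      using C(1) by (simp add: field_simps)
    also have "?s \<le> Sup S"
      using sS up by (intro cSup_upper bdd_aboveI) auto
    finally show "real m powr (1 / p) / (C + 1) \<le> fundamental_fun scale_fun (qnorm p) (unit_vec :: nat \<Rightarrow> nat \<Rightarrow> 'k) m"
      by (simp add: F)
    have "Sup S \<le> real m powr (1 / p)" using sS up by (intro cSup_least) auto
    also have "\<dots> \<le> (C + 1) * real m powr (1 / p)"
      using C(1) by (simp add: mult_le_cancel_right1)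
    finally show "fundamental_fun scale_fun (qnorm p) (unit_vec :: nat \<Rightarrow> nat \<Rightarrow> 'k) m \<le> (C + 1) * real m powr (1 / p)"
      by (simp add: F)
  qed
qed

text \<open>The truncated weight has norm at most 1, while its level set at the crossover has at
  least 2^j elements and height about 2^(-j/(2p)). The product of the height and the norm of the
  signs grows like 2^(j/p) 2^(-j/(2p)) = 2^(j/(2p)).\<close>

lemma not_truncation_quasi_greedy_unit_vec:
  "\<not> truncation_quasi_greedy scale_fun (qspace p :: (nat \<Rightarrow> 'k::{real_normed_field, banach}) set) (qnorm p) unit_vec"
proof
  assume "truncation_quasi_greedy scale_fun (qspace p :: (nat \<Rightarrow> 'k) set) (qnorm p) unit_vec"
  then obtain K where K: "\<And>(f :: nat \<Rightarrow> 'k) A. f \<in> qspace p \<Longrightarrow> A \<noteq> {} \<Longrightarrow>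
      greedy_set scale_fun (qnorm p) unit_vec f A \<Longrightarrow>
      Min ((\<lambda>n. norm (coord scale_fun (qnorm p) unit_vec f n)) ` A) *
        qnorm p (lin_comb scale_fun unit_vec (\<lambda>n. unit_sign (coord scale_fun (qnorm p) unit_vec f n)) A) \<le> K * qnorm p f"
    unfolding truncation_quasi_greedy_def by blast
  obtain C where C: "C \<ge> 0"
    "\<And>(f :: nat \<Rightarrow> 'k) A \<mu>. finite A \<Longrightarrow> 0 \<le> \<mu> \<Longrightarrow>
      (\<And>n. n \<in> A \<Longrightarrow> \<mu> \<le> norm (f n)) \<Longrightarrow> \<mu> * real (card A) powr (1 / p) \<le> C * qnorm p (restr f A)"
    using le_qnorm_of_support[OF p] by blast
  have bound: "(2 powr (1 / (2 * p))) ^ j \<le> 4 * C * \<bar>K\<bar>" for j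
  proof -
    define m :: nat where "m = 2 ^ (3 * j + 1)"
    define s where "s = 2 powr (- real j / (2 * p)) / 4"
    define f :: "nat \<Rightarrow> 'k" where "f = trunc m (\<lambda>n. of_real (weight p n))"
    define A where "A = {n. n < m \<and> s \<le> weight p n}"
    have s: "s > 0" by (simp add: s_def)
    have A: "finite A" by (simp add: A_def)
    have nf: "norm (f n) = (if n < m then weight p n else 0)" for n
      by (simp add: f_def trunc_def)
    have f: "f \<in> qspace p"
      by (rule finite_support_in_qspace[OF p, of "{..<m}"]) (auto simp: f_def trunc_def)
    note co = coord_unit_vec[OF f]
    \<comment> \<open>These are the multiples of 2^(2j) from 2^(3j) up to 2^(3j+1); there are 2^j of
      them, all of weight at least s.\<close>
    have "(\<lambda>q. 2 ^ (2 * j) * q) ` {2 ^ j..<2 ^ Suc j :: nat} \<subseteq> A"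
    proof
      fix n assume "n \<in> (\<lambda>q. 2 ^ (2 * j) * q) ` {2 ^ j..<2 ^ Suc j :: nat}"
      then obtain q where q: "2 ^ j \<le> q" "q < 2 ^ Suc j" "n = 2 ^ (2 * j) * q" by auto
      have "n < 2 ^ (2 * j) * 2 ^ Suc j" unfolding q(3) using q(2) by simp
      also have "\<dots> = 2 ^ (3 * j + 1)" by (simp add: power_add[symmetric])
      finally have "n < 2 ^ (3 * j + 1)" .
      moreover have "0 < n" using q by (auto intro!: gr0I)
      ultimately show "n \<in> A"
        using weight_ge_of_dvd[OF p, of n j] q(3) by (simp add: A_def m_def s_def)
    qed
    then have "card ((\<lambda>q. 2 ^ (2 * j) * q) ` {2 ^ j..<2 ^ Suc j :: nat}) \<le> card A"
      by (intro card_mono A)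
    also have "card ((\<lambda>q. 2 ^ (2 * j) * q) ` {2 ^ j..<2 ^ Suc j :: nat}) = 2 ^ j"
      by (subst card_image) (auto simp: inj_on_def)
    finally have cA: "2 ^ j \<le> card A" .
    then have "A \<noteq> {}" by auto
    have gr: "greedy_set scale_fun (qnorm p) unit_vec f A"
      unfolding greedy_set_def co nf using A s by (auto simp: A_def)
    have Ms: "s \<le> Min ((\<lambda>n. norm (f n)) ` A)"
      using A \<open>A \<noteq> {}\<close> by (subst Min_ge_iff) (auto simp: A_def nf)
    have "1 * real (card A) powr (1 / p) \<le> C * qnorm p (restr (\<lambda>n. unit_sign (f n)) A)"
      by (intro C(2) A) (auto simp: unit_sign_def norm_divide)
    moreover have "(2 ^ j) powr (1 / p) \<le> real (card A) powr (1 / p)"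
      using of_nat_mono[OF cA, where 'a = real] p by (intro powr_mono2) auto
    ultimately have 1: "(2 ^ j) powr (1 / p) \<le> C * qnorm p (restr (\<lambda>n. unit_sign (f n)) A)" by simp
    have q0: "0 \<le> qnorm p (restr (\<lambda>n. unit_sign (f n)) A)"
      by (intro qnorm_nonneg[OF p] qspace_representable[OF p] restr_in_qspace[OF p] A)
    have "s * qnorm p (restr (\<lambda>n. unit_sign (f n)) A) \<le> Min ((\<lambda>n. norm (f n)) ` A) * qnorm p (restr (\<lambda>n. unit_sign (f n)) A)"
      using Ms q0 by (rule mult_right_mono)
    also have "\<dots> \<le> K * qnorm p f"
      using K[OF f \<open>A \<noteq> {}\<close> gr] by (simp add: co lin_comb_unit_vec[OF A])
    \<comment> \<open>The absolute value covers a K of unknown sign.\<close>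
    also have "\<dots> \<le> \<bar>K\<bar> * 1"
    proof (rule mult_mono)
      show "qnorm p f \<le> 1"
        unfolding f_def by (intro qnorm_le[OF p] represents_trunc_weight)
      show "0 \<le> qnorm p f" by (intro qnorm_nonneg[OF p] qspace_representable[OF p f])
    qed auto
    finally have 2: "s * qnorm p (restr (\<lambda>n. unit_sign (f n)) A) \<le> \<bar>K\<bar>" by simp
    have "s * (2 ^ j) powr (1 / p) \<le> s * (C * qnorm p (restr (\<lambda>n. unit_sign (f n)) A))"
      using 1 s by (intro mult_left_mono) auto
    also have "\<dots> = C * (s * qnorm p (restr (\<lambda>n. unit_sign (f n)) A))" by simp
    also have "\<dots> \<le> C * \<bar>K\<bar>" using 2 C(1) by (rule mult_left_mono)
    finally have "4 * (s * (2 ^ j) powr (1 / p)) \<le> 4 * C * \<bar>K\<bar>" by simp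
    moreover have "4 * (s * (2 ^ j) powr (1 / p)) = (2 powr (1 / (2 * p))) ^ j"
    proof -
      have "4 * (s * (2 ^ j) powr (1 / p)) = 2 powr (- real j / (2 * p)) * 2 powr (real j * (1 / p))"
        by (simp add: s_def powr_realpow[symmetric] powr_powr)
      also have "\<dots> = 2 powr (1 / (2 * p) * real j)"
        unfolding powr_add[symmetric] using p by (intro arg_cong[where f = "(powr) 2"]) (simp add: field_simps)
      also have "\<dots> = (2 powr (1 / (2 * p))) ^ j"
        by (simp only: powr_powr[symmetric]) (simp add: powr_realpow)
      finally show ?thesis .
    qed
    ultimately show ?thesis by simp
  qed
  have "2 powr 0 < 2 powr (1 / (2 * p))" using p by (intro powr_less_mono) auto
  then obtain j where "4 * C * \<bar>K\<bar> < (2 powr (1 / (2 * p))) ^ j"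
    using real_arch_pow[of "2 powr (1 / (2 * p))"] by auto
  with bound[of j] show False by simp
qed

end

theorem theorem3p1:
  fixes p :: real
  assumes "1 \<le> p"
  shows "(\<exists>(smul :: real \<Rightarrow> (nat \<Rightarrow> real) \<Rightarrow> (nat \<Rightarrow> real)) X nrm x.
      banach_space_on smul X nrm \<and> schauder_basis smul X nrm x \<and> normalized nrm x \<and>
      (QGLC smul X nrm x \<and> LUCC smul nrm x \<and> LPU smul nrm x) \<and>
      (democratic nrm x \<and>
        (\<exists>C\<ge>1. \<forall>m\<ge>1. real m powr (1 / p) / C \<le> fundamental_fun smul nrm x m \<and>
          fundamental_fun smul nrm x m \<le> C * real m powr (1 / p))) \<and>
      \<not> truncation_quasi_greedy smul X nrm x) \<and>
    (\<exists>(smul :: complex \<Rightarrow> (nat \<Rightarrow> complex) \<Rightarrow> (nat \<Rightarrow> complex)) X nrm x.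
      banach_space_on smul X nrm \<and> schauder_basis smul X nrm x \<and> normalized nrm x \<and>
      (QGLC smul X nrm x \<and> LUCC smul nrm x \<and> LPU smul nrm x) \<and>
      (democratic nrm x \<and>
        (\<exists>C\<ge>1. \<forall>m\<ge>1. real m powr (1 / p) / C \<le> fundamental_fun smul nrm x m \<and>
          fundamental_fun smul nrm x m \<le> C * real m powr (1 / p))) \<and>
      \<not> truncation_quasi_greedy smul X nrm x)"
  \<comment> \<open>The construction works over any complete normed field, so the same witnesses
    serve the real and the complex case.\<close>
  by (rule conjI; rule exI[of _ scale_fun], rule exI[of _ "qspace p"], rule exI[of _ "qnorm p"],
      rule exI[of _ unit_vec], intro conjI banach_space_on_qspace schauder_basis_unit_vec
      normalized_unit_vec QGLC_unit_vec LUCC_unit_vec LPU_unit_vec democratic_unit_vec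
      fundamental_fun_unit_vec not_truncation_quasi_greedy_unit_vec assms)

end
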